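(* Let $X$ be a compact $0$-dimensional Hausdorff space with finitely many isolated points. If $C(X)$ is countably degree-$1$ saturated, then the Boolean algebra $CL(X)$ is countably saturated. Moreover, if $X$ has no isolated points, then $C(X)$ is countably degree-$1$ saturated if and only if $C(X)$ is countably saturated.
   Context: $CL(X)$ is the Boolean algebra of clopen subsets of $X$; a Boolean algebra is countably saturated if every finitely satisfiable type of cardinality $<\aleph_1$ (first-order language of Boolean algebras, with parameters) is realized. Continuous-logic formulas for $\mathrm{C}^*$-algebras are built from $\|P(\bar x)\|$ ($P$ a $^*$-polynomial with complex coefficients and parameters) by applying continuous functions $\mathbb R^n\to\mathbb R$ and $\sup_{\|y\|\le n}$, $\inf_{\|y\|\le n}$. For a class $\Phi$ of formulas, $C$ is countably $\Phi$-saturated if for all sequences $(\phi_n)$ from $\Phi$ with parameters in the unit ball $C_{\le1}$ and compact $K_n\subseteq\mathbb R$: whenever for every $\epsilon>0$ and finite $F\subseteq\mathbb N$ some $(b_k)\subseteq C_{\le1}$ has $\phi_n(\bar b)$ within $\epsilon$ of $K_n$ for $n\in F$, some $(b_k)\subseteq C_{\le1}$ has $\phi_n(\bar b)\in K_n$ for all $n$. Countably saturated: $\Phi$ all formulas. Countably degree-$1$ saturated: $\Phi$ the formulas $\|P(\bar x)\|$ with $P$ a $^*$-polynomial of degree at most $1$. *)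

theory Defs
  imports "HOL-Analysis.Analysis"
begin

record 'b ba_struct =
  ba_carrier :: "'b set"
  ba_inf :: "'b \<Rightarrow> 'b \<Rightarrow> 'b"
  ba_sup :: "'b \<Rightarrow> 'b \<Rightarrow> 'b"
  ba_compl :: "'b \<Rightarrow> 'b"
  ba_bot :: 'b
  ba_top :: 'b

datatype (ba_term_params: 'b) ba_term =
    BVar nat
  | BPar 'b
  | BBot
  | BTop
  | BInf "'b ba_term" "'b ba_term"
  | BSup "'b ba_term" "'b ba_term"
  | BCompl "'b ba_term"

datatype (ba_params: 'b) ba_form =
    BEq "'b ba_term" "'b ba_term"
  | BNeg "'b ba_form"
  | BConj "'b ba_form" "'b ba_form"
  | BDisj "'b ba_form" "'b ba_form"
  | BEx nat "'b ba_form"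
  | BAll nat "'b ba_form"

primrec ba_term_val :: "('b, 'm) ba_struct_scheme \<Rightarrow> (nat \<Rightarrow> 'b) \<Rightarrow> 'b ba_term \<Rightarrow> 'b" where
  "ba_term_val B s (BVar i) = s i"
| "ba_term_val B s (BPar a) = a"
| "ba_term_val B s BBot = ba_bot B"
| "ba_term_val B s BTop = ba_top B"
| "ba_term_val B s (BInf t u) = ba_inf B (ba_term_val B s t) (ba_term_val B s u)"
| "ba_term_val B s (BSup t u) = ba_sup B (ba_term_val B s t) (ba_term_val B s u)"
| "ba_term_val B s (BCompl t) = ba_compl B (ba_term_val B s t)"

fun ba_sat :: "('b, 'm) ba_struct_scheme \<Rightarrow> (nat \<Rightarrow> 'b) \<Rightarrow> 'b ba_form \<Rightarrow> bool" where
  "ba_sat B s (BEq t u) \<longleftrightarrow> ba_term_val B s t = ba_term_val B s u"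
| "ba_sat B s (BNeg \<phi>) \<longleftrightarrow> \<not> ba_sat B s \<phi>"
| "ba_sat B s (BConj \<phi> \<psi>) \<longleftrightarrow> ba_sat B s \<phi> \<and> ba_sat B s \<psi>"
| "ba_sat B s (BDisj \<phi> \<psi>) \<longleftrightarrow> ba_sat B s \<phi> \<or> ba_sat B s \<psi>"
| "ba_sat B s (BEx i \<phi>) \<longleftrightarrow> (\<exists>a\<in>ba_carrier B. ba_sat B (s(i := a)) \<phi>)"
| "ba_sat B s (BAll i \<phi>) \<longleftrightarrow> (\<forall>a\<in>ba_carrier B. ba_sat B (s(i := a)) \<phi>)"

text \<open>Types may have free variables \<open>x\<^sub>0, x\<^sub>1, \<dots>\<close> (possibly infinitely many) and parameters
  from the algebra; cardinality less than \<open>\<aleph>\<^sub>1\<close> means countable.\<close>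

definition ba_realized :: "('b, 'm) ba_struct_scheme \<Rightarrow> 'b ba_form set \<Rightarrow> bool" where
  "ba_realized B T \<longleftrightarrow> (\<exists>s. range s \<subseteq> ba_carrier B \<and> (\<forall>\<phi>\<in>T. ba_sat B s \<phi>))"

definition ba_countably_saturated :: "('b, 'm) ba_struct_scheme \<Rightarrow> bool" where
  "ba_countably_saturated B \<longleftrightarrow>
    (\<forall>T. countable T \<and> (\<forall>\<phi>\<in>T. ba_params \<phi> \<subseteq> ba_carrier B) \<and>
         (\<forall>F. finite F \<and> F \<subseteq> T \<longrightarrow> ba_realized B F)
      \<longrightarrow> ba_realized B T)"

definition CL :: "'a topology \<Rightarrow> 'a set ba_struct" where
  "CL X = \<lparr> ba_carrier = {U. openin X U \<and> closedin X U},
            ba_inf = (\<inter>), ba_sup = (\<union>), ba_compl = (\<lambda>U. topspace X - U),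
            ba_bot = {}, ba_top = topspace X \<rparr>"

record 'c cstar_struct =
  cs_carrier :: "'c set"
  cs_add :: "'c \<Rightarrow> 'c \<Rightarrow> 'c"
  cs_mult :: "'c \<Rightarrow> 'c \<Rightarrow> 'c"
  cs_scale :: "complex \<Rightarrow> 'c \<Rightarrow> 'c"
  cs_star :: "'c \<Rightarrow> 'c"
  cs_norm :: "'c \<Rightarrow> real"

definition cs_ball :: "('c, 'm) cstar_struct_scheme \<Rightarrow> real \<Rightarrow> 'c set" where
  "cs_ball C r = {a \<in> cs_carrier C. cs_norm C a \<le> r}"

text \<open>In a unital algebra the constant terms \<open>\<lambda>1\<close> arise as complex multiples of the
  parameter \<open>1\<close>, so there is no separate constructor for them.\<close>

datatype (sp_params: 'c) starpoly =
    SVar nat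
  | SPar 'c
  | SAdd "'c starpoly" "'c starpoly"
  | SMult "'c starpoly" "'c starpoly"
  | SScale complex "'c starpoly"
  | SStar "'c starpoly"

text \<open>The degree counts variables only: \<open>axb\<close> and \<open>ax\<^sup>*b\<close> with parameters \<open>a\<close>, \<open>b\<close>
  have degree 1.\<close>

primrec sp_degree :: "'c starpoly \<Rightarrow> nat" where
  "sp_degree (SVar i) = 1"
| "sp_degree (SPar a) = 0"
| "sp_degree (SAdd p q) = max (sp_degree p) (sp_degree q)"
| "sp_degree (SMult p q) = sp_degree p + sp_degree q"
| "sp_degree (SScale c p) = sp_degree p"
| "sp_degree (SStar p) = sp_degree p"

primrec sp_val :: "('c, 'm) cstar_struct_scheme \<Rightarrow> (nat \<Rightarrow> 'c) \<Rightarrow> 'c starpoly \<Rightarrow> 'c" where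
  "sp_val C s (SVar i) = s i"
| "sp_val C s (SPar a) = a"
| "sp_val C s (SAdd p q) = cs_add C (sp_val C s p) (sp_val C s q)"
| "sp_val C s (SMult p q) = cs_mult C (sp_val C s p) (sp_val C s q)"
| "sp_val C s (SScale c p) = cs_scale C c (sp_val C s p)"
| "sp_val C s (SStar p) = cs_star C (sp_val C s p)"

text \<open>\<open>CConn u [\<phi>\<^sub>0, \<dots>, \<phi>\<^sub>n\<^sub>-\<^sub>1]\<close> is the formula \<open>u(\<phi>\<^sub>0, \<dots>, \<phi>\<^sub>n\<^sub>-\<^sub>1)\<close>; \<open>CSup n i \<phi>\<close> is the supremum of
  \<open>\<phi>\<close> over all values of \<open>x\<^sub>i\<close> in the ball of radius \<open>n\<close>. Points of \<open>\<real>\<^sup>n\<close> are represented as in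
  \<^const>\<open>Euclidean_space\<close>, by sequences vanishing from index \<open>n\<close> on.\<close>

datatype (cf_params: 'c) cform =
    CNorm "'c starpoly"
  | CConn "(nat \<Rightarrow> real) \<Rightarrow> real" "'c cform list"
  | CSup nat nat "'c cform"
  | CInf nat nat "'c cform"

fun cf_wf :: "'c cform \<Rightarrow> bool" where
  "cf_wf (CNorm p) \<longleftrightarrow> True"
| "cf_wf (CConn u \<phi>s) \<longleftrightarrow>
     continuous_map (Euclidean_space (length \<phi>s)) euclideanreal u \<and> (\<forall>\<phi>\<in>set \<phi>s. cf_wf \<phi>)"
| "cf_wf (CSup n i \<phi>) \<longleftrightarrow> cf_wf \<phi>"
| "cf_wf (CInf n i \<phi>) \<longleftrightarrow> cf_wf \<phi>"

fun cf_val :: "('c, 'm) cstar_struct_scheme \<Rightarrow> (nat \<Rightarrow> 'c) \<Rightarrow> 'c cform \<Rightarrow> real" where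
  "cf_val C s (CNorm p) = cs_norm C (sp_val C s p)"
| "cf_val C s (CConn u \<phi>s) =
     u (\<lambda>j. if j < length \<phi>s then map (cf_val C s) \<phi>s ! j else 0)"
| "cf_val C s (CSup n i \<phi>) = (SUP y\<in>cs_ball C (real n). cf_val C (s(i := y)) \<phi>)"
| "cf_val C s (CInf n i \<phi>) = (INF y\<in>cs_ball C (real n). cf_val C (s(i := y)) \<phi>)"

definition countably_saturated_for ::
  "'c cform set \<Rightarrow> ('c, 'm) cstar_struct_scheme \<Rightarrow> bool" where
  "countably_saturated_for \<Phi> C \<longleftrightarrow>
    (\<forall>(\<phi> :: nat \<Rightarrow> 'c cform) (K :: nat \<Rightarrow> real set).
       (\<forall>n. \<phi> n \<in> \<Phi> \<and> cf_params (\<phi> n) \<subseteq> cs_ball C 1) \<and> (\<forall>n. compact (K n)) \<and>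
       (\<forall>\<epsilon>>0. \<forall>F. finite F \<longrightarrow>
          (\<exists>b. range b \<subseteq> cs_ball C 1 \<and> (\<forall>n\<in>F. \<exists>r\<in>K n. \<bar>cf_val C b (\<phi> n) - r\<bar> \<le> \<epsilon>)))
       \<longrightarrow> (\<exists>b. range b \<subseteq> cs_ball C 1 \<and> (\<forall>n. cf_val C b (\<phi> n) \<in> K n)))"

definition countably_saturated :: "('c, 'm) cstar_struct_scheme \<Rightarrow> bool" where
  "countably_saturated C \<longleftrightarrow> countably_saturated_for {\<phi>. cf_wf \<phi>} C"

definition countably_degree1_saturated :: "('c, 'm) cstar_struct_scheme \<Rightarrow> bool" where
  "countably_degree1_saturated C \<longleftrightarrow>
     countably_saturated_for {CNorm p | p. sp_degree p \<le> 1} C"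

text \<open>Continuous functions on \<open>X\<close> are normalised to be \<^const>\<open>undefined\<close> off the underlying set,
  so that elements of \<open>C(X)\<close> are equal iff they agree on \<open>X\<close>. The \<open>0\<close> in the supremum only
  matters for empty \<open>X\<close>.\<close>

definition CX :: "'a topology \<Rightarrow> ('a \<Rightarrow> complex) cstar_struct" where
  "CX X = \<lparr> cs_carrier = {f \<in> extensional (topspace X). continuous_map X euclidean f},
            cs_add = (\<lambda>f g. \<lambda>x\<in>topspace X. f x + g x),
            cs_mult = (\<lambda>f g. \<lambda>x\<in>topspace X. f x * g x),
            cs_scale = (\<lambda>c f. \<lambda>x\<in>topspace X. c * f x),
            cs_star = (\<lambda>f. \<lambda>x\<in>topspace X. cnj (f x)),
            cs_norm = (\<lambda>f. Sup (insert 0 ((\<lambda>x. cmod (f x)) ` topspace X))) \<rparr>"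

definition isolated_points :: "'a topology \<Rightarrow> 'a set" where
  "isolated_points X = {x \<in> topspace X. openin X {x}}"

end

theory Submission
  imports Defs
begin

text \<open>The conditions of degree 1 on a martingale \<open>(x\<^sub>\<sigma>)\<close> indexed by binary words (\<open>x\<^sub>\<sigma> = x\<^sub>\<sigma>\<^sub>0 + x\<^sub>\<sigma>\<^sub>1\<close>,
  \<open>0 \<le> Re x\<^sub>\<sigma> \<le> 1\<close>) together with \<open>\<parallel>1\<^sub>a x\<^sub>\<sigma>\<parallel> = 0\<close> or \<open>\<parallel>1\<^sub>a (1 + x\<^sub>\<sigma>)\<parallel> = 2\<close> prescribe which cells of a
  dyadic system of clopen partitions meet a given clopen set \<open>a\<close>; zero-dimensionality turns such a
  martingale back into clopen sets. Hence every limit, along a subsequence, of the quantifier-free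
  types of \<open>\<omega>\<close>-tuples of clopen sets over countably many parameters is realized.

  A back-and-forth argument shows that first-order formulas over \<open>CL(X)\<close> depend only on the
  quantifier-free type once the finitely many atoms are named, and that, without isolated points, the
  value of a formula over \<open>C(X)\<close> is a uniformly continuous function of the joint image of the variables
  and parameters. Elements of the unit ball of \<open>C(X)\<close> are coded by sequences of clopen sets, so in both
  structures a limit of approximate solutions can be realized.\<close>

subsection \<open>Clopen sets in Boolean spaces\<close>

text \<open>Being a projection, \<open>x^2 = x\<close>, is a condition of degree 2, and so is being
  a product of two unknowns. Intersections of the unknown sets are therefore not computed: each of
  them gets a variable of its own, and the relations left between the variables are linear. The
  solution need not consist of indicator functions. It is enough that the value 1 is attained in
  \<open>a\<close> where a cell has to meet \<open>a\<close>, and that the value is 0 on all of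
  \<open>a\<close> where it must not: clopen sets whose cells contain the points of value 1 and
  avoid the zeros then have the prescribed pattern. The limit pattern exists because the space of
  0-1 patterns is compact; the back-and-forth supplies the continuity of formulas with respect to
  patterns. Its obstacle is that finitely many types must be realized by distinct points. A nonempty
  open set without isolated points is infinite and leaves room; an isolated point can serve one type
  only, which has to be its own. Hence atoms become parameters in the Boolean case and are excluded
  in the metric case, where types are only approximate.\<close>

definition clopenin :: "'a topology \<Rightarrow> 'a set \<Rightarrow> bool" where
  "clopenin X U \<longleftrightarrow> openin X U \<and> closedin X U"

lemma clopenin_subset: "clopenin X U \<Longrightarrow> U \<subseteq> topspace X"
  by (auto simp: clopenin_def dest: openin_subset)

lemma clopenin_empty: "clopenin X {}"
  and clopenin_topspace: "clopenin X (topspace X)"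
  by (auto simp: clopenin_def)

lemma clopenin_Int: "clopenin X U \<Longrightarrow> clopenin X V \<Longrightarrow> clopenin X (U \<inter> V)"
  and clopenin_Un: "clopenin X U \<Longrightarrow> clopenin X V \<Longrightarrow> clopenin X (U \<union> V)"
  and clopenin_diff: "clopenin X U \<Longrightarrow> clopenin X V \<Longrightarrow> clopenin X (U - V)"
  by (auto simp: clopenin_def)

lemma clopenin_Union: "finite I \<Longrightarrow> (\<And>i. i \<in> I \<Longrightarrow> clopenin X (U i)) \<Longrightarrow> clopenin X (\<Union>i\<in>I. U i)"
  by (induction I rule: finite_induct) (auto intro: clopenin_Un clopenin_empty)

locale boolean_space =
  fixes X :: "'a topology"
  assumes compact: "compact_space X" and hausdorff: "Hausdorff_space X" and dim0: "X dim_le 0"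
begin

lemma clopen_base:
  assumes "openin X W" "x \<in> W"
  obtains U where "clopenin X U" "x \<in> U" "U \<subseteq> W"
proof -
  have "neighbourhood_base_of (\<lambda>U. closedin X U \<and> openin X U) X"
    using dim0 dimension_le_0_neighbourhood_base_of_clopen by blast
  then show thesis
    using assms that unfolding neighbourhood_base_of clopenin_def by (meson order_trans subsetD)
qed

text \<open>Clopen neighbourhoods of the points of \<open>A\<close> that miss \<open>B\<close> cover
  the compact set \<open>A\<close>, and a finite union of them is still clopen. This is how
  inequalities between real values are turned into clopen sets.\<close>

lemma clopen_separation:
  assumes "closedin X A" "closedin X B" "A \<inter> B = {}"
  obtains U where "clopenin X U" "A \<subseteq> U" "U \<inter> B = {}"
proof -
  have "\<exists>U. clopenin X U \<and> x \<in> U \<and> U \<subseteq> topspace X - B" if "x \<in> A" for x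
  proof -
    have "openin X (topspace X - B)" "x \<in> topspace X - B"
      using assms that closedin_subset by blast+
    then show ?thesis
      by (meson clopen_base)
  qed
  then obtain U where U: "clopenin X (U x)" "x \<in> U x" "U x \<subseteq> topspace X - B" if "x \<in> A" for x
    by metis
  have "compactin X A"
    using assms(1) compact closedin_compact_space by blast
  moreover have "openin X V" if "V \<in> U ` A" for V
    using U that by (auto simp: clopenin_def)
  moreover have "A \<subseteq> \<Union>(U ` A)"
    using U by auto
  ultimately obtain F where F: "finite F" "F \<subseteq> U ` A" "A \<subseteq> \<Union>F"
    by (meson compactinD)
  then obtain I where I: "finite I" "I \<subseteq> A" "F = U ` I"
    by (meson finite_subset_image)
  have "clopenin X (\<Union>i\<in>I. U i)"
    using I U by (intro clopenin_Union) auto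
  moreover have "(\<Union>i\<in>I. U i) \<inter> B = {}"
    using U I by blast
  ultimately show thesis
    using that F I by blast
qed

lemma singleton_closed: "x \<in> topspace X \<Longrightarrow> closedin X {x}"
  using Hausdorff_imp_t1_space[OF hausdorff] by (simp add: t1_space_closedin_singleton)

text \<open>If the set were finite, removing all points but \<open>x\<close> would remove a closed
  set and leave \<open>x\<close> isolated.\<close>

lemma infinite_open:
  assumes "openin X V" "x \<in> V" "V \<inter> isolated_points X = {}"
  shows "infinite V"
proof
  assume fin: "finite V"
  have sub: "V \<subseteq> topspace X"
    using assms(1) openin_subset by blast
  then have "closedin X (\<Union>y\<in>V - {x}. {y})"
    using fin by (intro closedin_Union) (auto intro: singleton_closed)
  then have "openin X (V - (\<Union>y\<in>V - {x}. {y}))"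
    using assms(1) by blast
  moreover have "V - (\<Union>y\<in>V - {x}. {y}) = {x}"
    using assms by auto
  ultimately show False
    using assms sub by (auto simp: isolated_points_def)
qed

lemma continuous_mapI_locally:
  fixes f :: "'a \<Rightarrow> 'b::metric_space"
  assumes "\<And>x e. x \<in> topspace X \<Longrightarrow> e > 0 \<Longrightarrow>
             \<exists>U. openin X U \<and> x \<in> U \<and> (\<forall>y\<in>U. dist (f x) (f y) < e)"
  shows "continuous_map X euclidean f"
  unfolding continuous_map_def
proof (intro conjI allI impI)
  fix W assume "openin euclidean (W :: 'b set)"
  show "openin X {x \<in> topspace X. f x \<in> W}"
  proof (subst openin_subopen, intro ballI)
    fix x assume x: "x \<in> {x \<in> topspace X. f x \<in> W}"
    moreover have "open W"
      using \<open>openin euclidean W\<close> by (metis open_openin)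
    ultimately obtain e where "e > 0" and e: "\<And>z. dist z (f x) < e \<Longrightarrow> z \<in> W"
      unfolding open_dist by (metis (mono_tags) mem_Collect_eq)
    moreover have "x \<in> topspace X"
      using x by simp
    ultimately obtain U where U: "openin X U" "x \<in> U" "\<forall>y\<in>U. dist (f x) (f y) < e"
      using assms[of x e] by metis
    have "U \<subseteq> {x \<in> topspace X. f x \<in> W}"
    proof
      fix y assume "y \<in> U"
      then show "y \<in> {x \<in> topspace X. f x \<in> W}"
        using e[of "f y"] U(3) openin_subset[OF U(1)] by (simp add: dist_commute subset_iff)
    qed
    with U show "\<exists>T. openin X T \<and> x \<in> T \<and> T \<subseteq> {x \<in> topspace X. f x \<in> W}"
      by blast
  qed
qed auto

lemma openin_ball_preimage:
  fixes f :: "'a \<Rightarrow> 'b::metric_space"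
  assumes "continuous_map X euclidean f"
  shows "openin X {x \<in> topspace X. dist c (f x) < e}"
proof -
  have "openin X {x \<in> topspace X. f x \<in> ball c e}"
    using assms by (intro openin_continuous_map_preimage) auto
  then show ?thesis
    by simp
qed

end

section \<open>Cells of a sequence of clopen sets, and limits of 0-1 patterns\<close>

definition cell :: "'a topology \<Rightarrow> (nat \<Rightarrow> 'a set) \<Rightarrow> bool list \<Rightarrow> 'a set" where
  "cell X b \<sigma> = {x \<in> topspace X. \<forall>i<length \<sigma>. (x \<in> b i) = \<sigma> ! i}"

lemma clopenin_Collect_iff:
  assumes "clopenin X U" shows "clopenin X {x \<in> topspace X. (x \<in> U) = e}"
proof -
  have "{x \<in> topspace X. (x \<in> U) = e} = (if e then U else topspace X - U)"
    using clopenin_subset[OF assms] by auto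
  then show ?thesis
    using assms clopenin_topspace by (auto intro: clopenin_diff)
qed

lemma clopenin_agree:
  fixes b :: "nat \<Rightarrow> 'a set"
  assumes "\<And>i. i < n \<Longrightarrow> clopenin X (b i)"
  shows "clopenin X {x \<in> topspace X. \<forall>i<n. (x \<in> b i) = e i}"
  using assms
proof (induction n)
  case (Suc n)
  have "{x \<in> topspace X. \<forall>i<Suc n. (x \<in> b i) = e i} =
        {x \<in> topspace X. \<forall>i<n. (x \<in> b i) = e i} \<inter> {x \<in> topspace X. (x \<in> b n) = e n}"
    by (auto simp: less_Suc_eq)
  then show ?case
    using Suc by (auto intro!: clopenin_Int clopenin_Collect_iff)
qed (simp add: clopenin_topspace)

lemma clopenin_cell: "(\<And>i. clopenin X (b i)) \<Longrightarrow> clopenin X (cell X b \<sigma>)"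
  unfolding cell_def by (rule clopenin_agree)

lemma cell_snoc: "cell X b (\<sigma> @ [e]) = cell X b \<sigma> \<inter> {x. (x \<in> b (length \<sigma>)) = e}"
  by (auto simp: cell_def less_Suc_eq nth_append)

lemma cell_Nil: "cell X b [] = topspace X"
  by (simp add: cell_def)

text \<open>Sequential compactness of the Cantor space: bit by bit, a value is kept that still
  occurs at infinitely many \<open>m\<close>. Every finite part of \<open>d\<close> recurs at
  arbitrarily large \<open>m\<close>, though no single \<open>m\<close> need show all of it.\<close>

lemma infinitely_often_pattern:
  fixes Q :: "nat \<Rightarrow> nat \<Rightarrow> bool"
  obtains d where "\<And>N. infinite {m. \<forall>k<N. Q m k = d k}"
proof -
  define S where "S = rec_nat UNIV (\<lambda>n T. if infinite {m\<in>T. Q m n} then {m\<in>T. Q m n} else {m\<in>T. \<not> Q m n})"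
  define d where "d n = infinite {m\<in>S n. Q m n}" for n
  have S0: "S 0 = UNIV" and SS: "S (Suc n) = {m\<in>S n. Q m n = d n}" for n
    by (auto simp: S_def d_def)
  have "infinite (S n)" for n
  proof (induction n)
    case (Suc n)
    have "S n = {m\<in>S n. Q m n} \<union> {m\<in>S n. \<not> Q m n}"
      by auto
    then have "infinite {m\<in>S n. Q m n} \<or> infinite {m\<in>S n. \<not> Q m n}"
      using Suc by (metis finite_UnI)
    then show ?case
      unfolding SS d_def by (cases "infinite {m\<in>S n. Q m n}") auto
  qed (simp add: S0)
  moreover have "S N = {m. \<forall>k<N. Q m k = d k}" for N
    by (induction N) (auto simp: S0 SS less_Suc_eq)
  ultimately have "infinite {m. \<forall>k<N. Q m k = d k}" for N
    by metis
  then show thesis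
    using that by blast
qed

section \<open>Norms and balls of the algebra C(X)\<close>

lemma cs_ball_mono: "r \<le> r' \<Longrightarrow> cs_ball C r \<subseteq> cs_ball C r'"
  by (auto simp: cs_ball_def)

lemma CX_norm_ge:
  assumes "bdd_above ((\<lambda>x. cmod (f x)) ` topspace X)" "x \<in> topspace X"
  shows "cmod (f x) \<le> cs_norm (CX X) f"
  using assms by (auto simp: CX_def intro!: cSup_upper)

lemma CX_norm_le:
  assumes "0 \<le> r" "\<And>x. x \<in> topspace X \<Longrightarrow> cmod (f x) \<le> r"
  shows "cs_norm (CX X) f \<le> r"
  using assms by (auto simp: CX_def intro!: cSup_least)

lemma CX_norm_nonneg:
  assumes "bdd_above ((\<lambda>x. cmod (f x)) ` topspace X)"
  shows "0 \<le> cs_norm (CX X) f"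
  using assms by (auto simp: CX_def intro!: cSup_upper)

lemma CX_norm_eq_0:
  assumes "\<And>x. x \<in> topspace X \<Longrightarrow> f x = 0"
  shows "cs_norm (CX X) f = 0"
proof -
  have "insert 0 ((\<lambda>x. cmod (f x)) ` topspace X) = {0}"
    using assms by auto
  then have "Sup (insert 0 ((\<lambda>x. cmod (f x)) ` topspace X)) = 0"
    by (metis cSup_singleton)
  then show ?thesis
    by (simp only: CX_def cstar_struct.simps)
qed

lemma CX_norm_eqI:
  assumes "x \<in> topspace X" "cmod (f x) = r" "\<And>y. y \<in> topspace X \<Longrightarrow> cmod (f y) \<le> r"
  shows "cs_norm (CX X) f = r"
  unfolding CX_def using assms by (auto intro!: cSup_eq_maximum order_trans[OF norm_ge_zero[of "f x"]])

lemma CX_sels: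
  "cs_add (CX X) f g = (\<lambda>x\<in>topspace X. f x + g x)"
  "cs_mult (CX X) f g = (\<lambda>x\<in>topspace X. f x * g x)"
  "cs_scale (CX X) c f = (\<lambda>x\<in>topspace X. c * f x)"
  "cs_star (CX X) f = (\<lambda>x\<in>topspace X. cnj (f x))"
  by (simp_all add: CX_def)

lemma CX_carrier: "cs_carrier (CX X) = {f \<in> extensional (topspace X). continuous_map X euclidean f}"
  by (simp add: CX_def)

context boolean_space
begin

lemma compact_image:
  fixes f :: "'a \<Rightarrow> 'b::topological_space"
  assumes "continuous_map X euclidean f"
  shows "compact (f ` topspace X)"
  using image_compactin[OF _ assms, of "topspace X"] compact by (simp add: compact_space_def)

lemma continuous_cmod:
  "continuous_map X euclidean f \<Longrightarrow> continuous_map X euclidean (\<lambda>x. cmod (f x))"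
  using continuous_map_compose[of X euclidean f euclidean cmod]
  by (simp add: o_def continuous_on_norm)

lemma CX_bdd:
  assumes "continuous_map X euclidean f"
  shows "bdd_above ((\<lambda>x. cmod (f x)) ` topspace X)"
  using compact_image[OF continuous_cmod[OF assms]] by (metis compact_imp_bounded bounded_imp_bdd_above)

text \<open>By compactness the supremum is a maximum. Positivity excludes the empty space, whose
  norm is the default value 0.\<close>

lemma CX_norm_attained:
  assumes "continuous_map X euclidean f" "cs_norm (CX X) f > 0"
  obtains x where "x \<in> topspace X" "cmod (f x) = cs_norm (CX X) f"
proof -
  have "topspace X \<noteq> {}"
    using assms(2) by (auto simp: CX_def)
  then obtain x where x: "x \<in> topspace X" "\<And>y. y \<in> topspace X \<Longrightarrow> cmod (f y) \<le> cmod (f x)"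
    using compact_attains_sup[OF compact_image[OF continuous_cmod[OF assms(1)]]] by auto
  then have "cs_norm (CX X) f = cmod (f x)"
    by (intro CX_norm_eqI) auto
  with x show thesis
    using that by simp
qed

text \<open>\<open>0 \<le> r\<close> has to be listed because the pointwise bound is void on an
  empty space.\<close>

lemma mem_CX_ball:
  "f \<in> cs_ball (CX X) r \<longleftrightarrow>
     f \<in> extensional (topspace X) \<and> continuous_map X euclidean f \<and> 0 \<le> r \<and> (\<forall>x\<in>topspace X. cmod (f x) \<le> r)"
  using CX_norm_ge[OF CX_bdd, of f] CX_norm_le[of r X f] CX_norm_nonneg[OF CX_bdd, of f]
  by (auto simp: cs_ball_def CX_carrier) (meson order_trans)+

lemma CX_ball_bound: "f \<in> cs_ball (CX X) r \<Longrightarrow> x \<in> topspace X \<Longrightarrow> cmod (f x) \<le> r"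
  by (simp add: mem_CX_ball)

lemma CX_zero_ball: "0 \<le> r \<Longrightarrow> (\<lambda>x\<in>topspace X. 0) \<in> cs_ball (CX X) r"
  by (auto simp: mem_CX_ball intro: continuous_map_eq[OF continuous_map_const[THEN iffD2]])

lemma continuous_map_locally_constant:
  assumes "\<And>c. c \<in> w ` topspace X \<Longrightarrow> openin X {x \<in> topspace X. w x = c}"
  shows "continuous_map X euclidean (\<lambda>x. h (w x) :: 'b::metric_space)"
proof (rule continuous_mapI_locally)
  fix x e assume "x \<in> topspace X" "(0::real) < e"
  then show "\<exists>U. openin X U \<and> x \<in> U \<and> (\<forall>y\<in>U. dist (h (w x)) (h (w y)) < e)"
    using assms[of "w x"] by (intro exI[of _ "{y \<in> topspace X. w y = w x}"]) auto
qed

lemma sp_val_continuous: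
  assumes "\<And>v. continuous_map X euclidean (s v)" "\<And>a. a \<in> sp_params p \<Longrightarrow> continuous_map X euclidean a"
  shows "continuous_map X euclidean (sp_val (CX X) s p)"
proof -
  have restr: "continuous_map X euclidean (restrict f (topspace X))"
    if "continuous_map X euclidean f" for f :: "'a \<Rightarrow> complex"
    using that by (auto elim: continuous_map_eq)
  show ?thesis
    using assms(2)
  proof (induction p)
    case (SVar v)
    then show ?case
      using assms(1) by simp
  next
    case (SPar a)
    then show ?case
      by simp
  next
    case (SAdd p q)
    then have "continuous_map X euclidean (sp_val (CX X) s p)" "continuous_map X euclidean (sp_val (CX X) s q)"
      by simp_all
    then show ?case
      unfolding sp_val.simps CX_sels by (intro restr) (simp add: continuous_map_atin tendsto_add)
  next
    case (SMult p q)
    then have "continuous_map X euclidean (sp_val (CX X) s p)" "continuous_map X euclidean (sp_val (CX X) s q)"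
      by simp_all
    then show ?case
      unfolding sp_val.simps CX_sels by (intro restr) (simp add: continuous_map_atin tendsto_mult)
  next
    case (SScale c p)
    then have "continuous_map X euclidean (sp_val (CX X) s p)"
      by simp
    then show ?case
      unfolding sp_val.simps CX_sels by (intro restr) (simp add: continuous_map_atin tendsto_mult)
  next
    case (SStar p)
    then have "continuous_map X euclidean (sp_val (CX X) s p)"
      by simp
    then show ?case
      unfolding sp_val.simps CX_sels by (intro restr) (simp add: continuous_map_atin tendsto_cnj)
  qed
qed

section \<open>Indicator functions and the conditions of degree 1\<close>

definition ind :: "'a set \<Rightarrow> 'a \<Rightarrow> complex" where
  "ind U = (\<lambda>x\<in>topspace X. if x \<in> U then 1 else 0)"

lemma ind_ball: assumes "clopenin X U" shows "ind U \<in> cs_ball (CX X) 1"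
proof -
  have "clopenin X {x \<in> topspace X. (x \<in> U) = c}" for c
    by (rule clopenin_Collect_iff[OF assms])
  then have "continuous_map X euclidean (\<lambda>x. (if x \<in> U then 1 else 0) :: complex)"
    using continuous_map_locally_constant[of "\<lambda>x. x \<in> U" "\<lambda>c. if c then 1 else (0::complex)"]
    by (simp add: clopenin_def)
  then show ?thesis
    by (auto simp: ind_def mem_CX_ball elim: continuous_map_eq)
qed

text \<open>Indicator functions of the cells of a dyadic system of clopen partitions form a martingale;
  being a martingale is expressible by conditions of degree 1, being an indicator function is not.\<close>

lemma degree1_martingale:
  fixes d :: "bool list \<Rightarrow> bool list \<Rightarrow> bool"
  assumes sat: "countably_degree1_saturated (CX X)"
    and G: "\<And>i. clopenin X (G i)"
    and approx: "\<And>N. \<exists>b. (\<forall>i. clopenin X (b i)) \<and>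
        (\<forall>\<sigma> \<tau>. length \<sigma> \<le> N \<and> length \<tau> \<le> N \<longrightarrow> (cell X b \<sigma> \<inter> cell X G \<tau> \<noteq> {}) = d \<sigma> \<tau>)"
  obtains y :: "bool list \<Rightarrow> 'a \<Rightarrow> complex"
    where "\<And>\<sigma>. continuous_map X euclidean (y \<sigma>)"
      and "\<And>\<sigma> x. x \<in> topspace X \<Longrightarrow> cmod (y \<sigma> x) \<le> 1"
      and "\<And>\<sigma> x. x \<in> topspace X \<Longrightarrow> cmod (1 - y \<sigma> x) \<le> 1"
      and "\<And>\<sigma> x. x \<in> topspace X \<Longrightarrow> y \<sigma> x = y (\<sigma> @ [True]) x + y (\<sigma> @ [False]) x"
      and "\<And>x. x \<in> topspace X \<Longrightarrow> y [] x = 1"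
      and "\<And>\<sigma> \<tau>. d \<sigma> \<tau> \<Longrightarrow> \<exists>x\<in>cell X G \<tau>. cmod (1 + y \<sigma> x) = 2"
      and "\<And>\<sigma> \<tau> x. \<not> d \<sigma> \<tau> \<Longrightarrow> x \<in> cell X G \<tau> \<Longrightarrow> y \<sigma> x = 0"
proof -
  let ?C = "CX X"
  let ?one = "SPar (ind (topspace X))"
  define V where "V \<sigma> = (SVar (to_nat \<sigma>) :: ('a \<Rightarrow> complex) starpoly)" for \<sigma> :: "bool list"
  define sub where "sub p q = SAdd p (SScale (- 1) q)" for p q :: "('a \<Rightarrow> complex) starpoly"
  \<comment> \<open>Indices 0, 1 and 2 stand for the bound on \<open>1 - y\<close>, additivity over
    the two children and value 1 at the root; every larger \<open>k\<close> repeats the condition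
    that links \<sigma> with \<tau>. The factor \<open>ind (cell X G \<tau>)\<close> is a parameter,
    so the product keeps degree 1.\<close>
  define P where "P k \<sigma> \<tau> = (if k = 0 then sub ?one (V \<sigma>)
     else if k = 1 then sub (V \<sigma>) (SAdd (V (\<sigma> @ [True])) (V (\<sigma> @ [False])))
     else if k = 2 then sub ?one (V [])
     else if d \<sigma> \<tau> then SMult (SPar (ind (cell X G \<tau>))) (SAdd ?one (V \<sigma>))
     else SMult (SPar (ind (cell X G \<tau>))) (V \<sigma>))" for k :: nat and \<sigma> \<tau>
  \<comment> \<open>As \<open>cmod y \<le> 1\<close>, the norm 2 of \<open>1 + y\<close> can only
    come from a point with \<open>y = 1\<close>; prescribing the norm of \<open>y\<close> itself
    would fix no more than a modulus.\<close>
  define L where "L k \<sigma> \<tau> = (if k = 0 then {0..1} else if k = 1 then {0} else if k = 2 then {0}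
     else if d \<sigma> \<tau> then {2} else {0::real})" for k :: nat and \<sigma> \<tau>
  define idx where "idx n = (from_nat n :: nat \<times> bool list \<times> bool list)" for n
  define \<phi> where "\<phi> n = (case idx n of (k, \<sigma>, \<tau>) \<Rightarrow> CNorm (P k \<sigma> \<tau>))" for n
  define K where "K n = (case idx n of (k, \<sigma>, \<tau>) \<Rightarrow> L k \<sigma> \<tau>)" for n
  have par: "ind (topspace X) \<in> cs_ball ?C 1" "ind (cell X G \<tau>) \<in> cs_ball ?C 1" for \<tau>
    by (intro ind_ball clopenin_topspace clopenin_cell G)+
  have deg: "\<phi> n \<in> {CNorm p |p. sp_degree p \<le> 1} \<and> cf_params (\<phi> n) \<subseteq> cs_ball ?C 1" for n
    using par by (auto simp: \<phi>_def P_def V_def sub_def split: prod.splits)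
  have comp: "compact (K n)" for n
    by (auto simp: K_def L_def split: prod.splits)
  \<comment> \<open>Finitely many conditions involve words up to some length \<open>N\<close> only,
    and the indicator functions of the cells of a suitable \<open>b\<close> meet them
    exactly.\<close>
  have fin: "\<exists>s. range s \<subseteq> cs_ball ?C 1 \<and> (\<forall>n\<in>F. cf_val ?C s (\<phi> n) \<in> K n)" if "finite F" for F
  proof -
    define N where "N = Max (insert 0 ((\<lambda>n. length (fst (snd (idx n)))) ` F \<union> (\<lambda>n. length (snd (snd (idx n)))) ` F))"
    have N: "length \<sigma> \<le> N \<and> length \<tau> \<le> N" if "n \<in> F" "idx n = (k, \<sigma>, \<tau>)" for n k \<sigma> \<tau>
      unfolding N_def using that \<open>finite F\<close> by (force intro!: Max_ge)
    obtain b where b: "\<And>i. clopenin X (b i)" and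
      bd: "\<And>\<sigma> \<tau>. length \<sigma> \<le> N \<and> length \<tau> \<le> N \<Longrightarrow> (cell X b \<sigma> \<inter> cell X G \<tau> \<noteq> {}) = d \<sigma> \<tau>"
      using approx by metis
    define s where "s v = ind (cell X b (from_nat v))" for v
    have rs: "range s \<subseteq> cs_ball ?C 1"
      unfolding s_def by (auto intro!: ind_ball clopenin_cell b)
    have "cf_val ?C s (CNorm (P k \<sigma> \<tau>)) \<in> L k \<sigma> \<tau>" if len: "length \<sigma> \<le> N" "length \<tau> \<le> N" for k \<sigma> \<tau>
    proof -
      consider "k = 0" | "k = 1" | "k = 2" | "k > 2" "d \<sigma> \<tau>" | "k > 2" "\<not> d \<sigma> \<tau>"
        by fastforce
      then show ?thesis
      proof cases
        case 1
        have "cs_norm ?C (sp_val ?C s (sub ?one (V \<sigma>))) \<le> 1"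
          by (rule CX_norm_le) (auto simp: sub_def V_def s_def ind_def CX_def)
        moreover have "0 \<le> cs_norm ?C (sp_val ?C s (sub ?one (V \<sigma>)))"
          by (rule CX_norm_nonneg, rule bdd_aboveI2[where M = 1])
            (auto simp: sub_def V_def s_def ind_def CX_def)
        ultimately show ?thesis
          using 1 by (simp add: P_def L_def)
      next
        case 2
        have "cs_norm ?C (sp_val ?C s (sub (V \<sigma>) (SAdd (V (\<sigma> @ [True])) (V (\<sigma> @ [False]))))) = 0"
          by (rule CX_norm_eq_0) (auto simp: sub_def V_def s_def ind_def CX_def cell_snoc)
        then show ?thesis
          using 2 by (simp add: P_def L_def)
      next
        case 3
        have "cs_norm ?C (sp_val ?C s (sub ?one (V []))) = 0"
          by (rule CX_norm_eq_0) (auto simp: sub_def V_def s_def ind_def CX_def cell_Nil)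
        then show ?thesis
          using 3 by (simp add: P_def L_def)
      next
        case 4
        then obtain x where "x \<in> cell X b \<sigma>" "x \<in> cell X G \<tau>"
          using bd len by blast
        moreover from this have "x \<in> topspace X"
          by (simp add: cell_def)
        ultimately have "cs_norm ?C (sp_val ?C s (SMult (SPar (ind (cell X G \<tau>))) (SAdd ?one (V \<sigma>)))) = 2"
          by (intro CX_norm_eqI[of x]) (auto simp: sub_def V_def s_def ind_def CX_def)
        then show ?thesis
          using 4 by (simp add: P_def L_def)
      next
        case 5
        then have "cell X b \<sigma> \<inter> cell X G \<tau> = {}"
          using bd len by blast
        then have "cs_norm ?C (sp_val ?C s (SMult (SPar (ind (cell X G \<tau>))) (V \<sigma>))) = 0"
          by (intro CX_norm_eq_0) (auto simp: sub_def V_def s_def ind_def CX_def)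
        then show ?thesis
          using 5 by (simp add: P_def L_def)
      qed
    qed
    then have "cf_val ?C s (\<phi> n) \<in> K n" if "n \<in> F" for n
      using N that by (cases "idx n") (auto simp: \<phi>_def K_def)
    with rs show ?thesis
      by blast
  qed
  have "\<exists>s. range s \<subseteq> cs_ball ?C 1 \<and> (\<forall>n. cf_val ?C s (\<phi> n) \<in> K n)"
  proof -
    have "\<forall>\<epsilon>>0. \<forall>F. finite F \<longrightarrow>
          (\<exists>b. range b \<subseteq> cs_ball ?C 1 \<and> (\<forall>n\<in>F. \<exists>r\<in>K n. \<bar>cf_val ?C b (\<phi> n) - r\<bar> \<le> \<epsilon>))"
    proof (intro allI impI)
      fix \<epsilon> :: real and F :: "nat set" assume "\<epsilon> > 0" "finite F"
      obtain s where s: "range s \<subseteq> cs_ball ?C 1" "\<And>n. n \<in> F \<Longrightarrow> cf_val ?C s (\<phi> n) \<in> K n"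
        using fin[OF \<open>finite F\<close>] by metis
      have "\<exists>r\<in>K n. \<bar>cf_val ?C s (\<phi> n) - r\<bar> \<le> \<epsilon>" if "n \<in> F" for n
        using s(2)[OF that] \<open>\<epsilon> > 0\<close> by (intro bexI[of _ "cf_val ?C s (\<phi> n)"]) simp_all
      with s(1) show "\<exists>b. range b \<subseteq> cs_ball ?C 1 \<and> (\<forall>n\<in>F. \<exists>r\<in>K n. \<bar>cf_val ?C b (\<phi> n) - r\<bar> \<le> \<epsilon>)"
        by blast
    qed
    then show ?thesis
      using sat deg comp unfolding countably_degree1_saturated_def countably_saturated_for_def by blast
  qed
  then obtain s where s: "range s \<subseteq> cs_ball ?C 1" and sK: "\<And>n. cf_val ?C s (\<phi> n) \<in> K n"
    by blast
  have val: "cs_norm ?C (sp_val ?C s (P k \<sigma> \<tau>)) \<in> L k \<sigma> \<tau>" for k \<sigma> \<tau>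
    using sK[of "to_nat (k, \<sigma>, \<tau>)"] by (simp add: \<phi>_def K_def idx_def)
  define y where "y \<sigma> = s (to_nat \<sigma>)" for \<sigma> :: "bool list"
  have scont: "continuous_map X euclidean (s v)" for v
    using s by (auto simp: mem_CX_ball image_subset_iff)
  have y: "y \<sigma> \<in> cs_ball ?C 1" for \<sigma>
    using s by (auto simp: y_def)
  have cont: "continuous_map X euclidean (y \<sigma>)" and le1: "x \<in> topspace X \<Longrightarrow> cmod (y \<sigma> x) \<le> 1" for \<sigma> x
    using y[of \<sigma>] by (simp_all add: mem_CX_ball)
  have contP: "continuous_map X euclidean (sp_val ?C s (P k \<sigma> \<tau>))" for k \<sigma> \<tau>
  proof (rule sp_val_continuous[OF scont])
    fix a assume "a \<in> sp_params (P k \<sigma> \<tau>)"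
    then have "a \<in> cs_ball ?C 1"
      using par by (auto simp: P_def sub_def V_def split: if_splits)
    then show "continuous_map X euclidean a"
      by (simp add: mem_CX_ball)
  qed
  have pt: "cmod (sp_val ?C s (P k \<sigma> \<tau>) x) \<le> cs_norm ?C (sp_val ?C s (P k \<sigma> \<tau>))"
    if "x \<in> topspace X" for k \<sigma> \<tau> x
    by (rule CX_norm_ge[OF CX_bdd[OF contP] that])
  have a: "cmod (1 - y \<sigma> x) \<le> 1" if "x \<in> topspace X" for \<sigma> x
    using pt[OF that, of 0 \<sigma> "[]"] val[of 0 \<sigma> "[]"] that
    by (auto simp: P_def L_def sub_def V_def CX_def y_def ind_def)
  have b: "y \<sigma> x = y (\<sigma> @ [True]) x + y (\<sigma> @ [False]) x" if "x \<in> topspace X" for \<sigma> x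
  proof -
    have "y \<sigma> x + - (y (\<sigma> @ [True]) x + y (\<sigma> @ [False]) x) = 0"
      using pt[OF that, of 1 \<sigma> "[]"] val[of 1 \<sigma> "[]"] that
      by (simp add: P_def L_def sub_def V_def CX_sels y_def)
    then show ?thesis
      by (simp only: eq_neg_iff_add_eq_0[symmetric] minus_minus)
  qed
  have c: "y [] x = 1" if "x \<in> topspace X" for x
    using pt[OF that, of 2 "[]" "[]"] val[of 2 "[]" "[]"] that
    by (simp add: P_def L_def sub_def V_def CX_def y_def ind_def)
  have e: "\<exists>x\<in>cell X G \<tau>. cmod (1 + y \<sigma> x) = 2" if "d \<sigma> \<tau>" for \<sigma> \<tau>
  proof -
    \<comment> \<open>Compactness turns the norm 2 into a point. It lies in the cell of \<tau>,
      because the product vanishes elsewhere.\<close>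
    have two: "cs_norm ?C (sp_val ?C s (P 3 \<sigma> \<tau>)) = 2"
      using val[of 3 \<sigma> \<tau>] that by (simp add: L_def)
    then obtain x where x: "x \<in> topspace X" "cmod (sp_val ?C s (P 3 \<sigma> \<tau>) x) = 2"
      using CX_norm_attained[OF contP, of 3 \<sigma> \<tau>] by auto
    then show ?thesis
      using that by (intro bexI[of _ x]) (auto simp: P_def V_def CX_def y_def ind_def split: if_splits)
  qed
  have f: "y \<sigma> x = 0" if "\<not> d \<sigma> \<tau>" "x \<in> cell X G \<tau>" for \<sigma> \<tau> x
  proof -
    have x: "x \<in> topspace X"
      using that by (simp add: cell_def)
    show ?thesis
      using pt[OF x, of 3 \<sigma> \<tau>] val[of 3 \<sigma> \<tau>] that x
      by (simp add: P_def L_def V_def CX_def y_def ind_def)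
  qed
  show thesis
    by (rule that[OF cont le1 a b c e f])
qed

end

subsection \<open>Realizing patterns of clopen sets\<close>

context boolean_space
begin

text \<open>On the cell of \<open>\<sigma>\<close> the martingale stays above \<open>3 ^ - length \<sigma>\<close>; since its two successors
  cannot both be below a third of that, the cell can be split by a clopen set.\<close>

lemma martingale_cells:
  fixes y :: "bool list \<Rightarrow> 'a \<Rightarrow> complex"
  assumes cont: "\<And>\<sigma>. continuous_map X euclidean (y \<sigma>)"
    and le1: "\<And>\<sigma> x. x \<in> topspace X \<Longrightarrow> cmod (y \<sigma> x) \<le> 1"
    and pos: "\<And>\<sigma> x. x \<in> topspace X \<Longrightarrow> cmod (1 - y \<sigma> x) \<le> 1"
    and add: "\<And>\<sigma> x. x \<in> topspace X \<Longrightarrow> y \<sigma> x = y (\<sigma> @ [True]) x + y (\<sigma> @ [False]) x"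
    and one: "\<And>x. x \<in> topspace X \<Longrightarrow> y [] x = 1"
  obtains b where "\<And>i. clopenin X (b i)"
    and "\<And>\<sigma> x. x \<in> cell X b \<sigma> \<Longrightarrow> y \<sigma> x \<noteq> 0"
    and "\<And>\<sigma> x. x \<in> topspace X \<Longrightarrow> cmod (1 + y \<sigma> x) = 2 \<Longrightarrow> x \<in> cell X b \<sigma>"
proof -
  define r where "r \<sigma> x = Re (y \<sigma> x)" for \<sigma> x
  have r0: "0 \<le> r \<sigma> x" and r1: "r \<sigma> x \<le> 1" if "x \<in> topspace X" for \<sigma> x
  proof -
    show "0 \<le> r \<sigma> x"
      using pos[OF that, of \<sigma>] complex_Re_le_cmod[of "1 - y \<sigma> x"] by (simp add: r_def)
    show "r \<sigma> x \<le> 1"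
      using le1[OF that, of \<sigma>] complex_Re_le_cmod[of "y \<sigma> x"] by (simp add: r_def)
  qed
  have radd: "r \<sigma> x = r (\<sigma> @ [True]) x + r (\<sigma> @ [False]) x" if "x \<in> topspace X" for \<sigma> x
    unfolding r_def by (subst add[OF that]) simp
  have rone: "r [] x = 1" if "x \<in> topspace X" for x
    by (simp add: r_def one that)
  have rcont: "continuous_map X euclidean (r \<sigma>)" for \<sigma>
    using continuous_map_compose[OF cont[of \<sigma>], of euclidean Re]
    by (simp add: o_def r_def[abs_def] continuous_on_Re)
  have geq: "closedin X {x \<in> topspace X. c \<le> r \<sigma> x}" and leq: "closedin X {x \<in> topspace X. r \<sigma> x \<le> c}" for c \<sigma>
    using closedin_continuous_map_preimage[OF rcont, of "{c..}"]
      closedin_continuous_map_preimage[OF rcont, of "{..c}"] by simp_all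
  \<comment> \<open>On \<open>A \<sigma> e\<close> the child \<open>e\<close> has dropped to a third
    of the bound valid at \<sigma>, so the path must turn to the other child. The inequalities are
    not strict in order that the set be closed.\<close>
  define A where "A \<sigma> e = {x \<in> topspace X. 1 / 3 ^ length \<sigma> \<le> r \<sigma> x} \<inter>
      {x \<in> topspace X. r (\<sigma> @ [e]) x \<le> 1 / 3 ^ Suc (length \<sigma>)}" for \<sigma> e
  have "\<exists>U. clopenin X U \<and> A \<sigma> False \<subseteq> U \<and> U \<inter> A \<sigma> True = {}" for \<sigma>
  proof -
    have "closedin X (A \<sigma> e)" for e
      unfolding A_def by (intro closedin_Int geq leq)
    moreover have "A \<sigma> False \<inter> A \<sigma> True = {}"
    proof -
      have False if x: "x \<in> A \<sigma> False" "x \<in> A \<sigma> True" for x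
      proof -
        define q where "q = (1::real) / 3 ^ length \<sigma>"
        have "0 < q" "1 / 3 ^ Suc (length \<sigma>) = q / 3"
          by (simp_all add: q_def)
        then show False
          using x radd[of x \<sigma>] unfolding A_def q_def[symmetric] by simp
      qed
      then show ?thesis
        by blast
    qed
    ultimately show ?thesis
      using clopen_separation by metis
  qed
  then obtain U where U: "\<And>\<sigma>. clopenin X (U \<sigma>)" "\<And>\<sigma>. A \<sigma> False \<subseteq> U \<sigma>" "\<And>\<sigma>. U \<sigma> \<inter> A \<sigma> True = {}"
    by metis
  \<comment> \<open>Each point gets an itinerary through the binary tree, \<open>U \<sigma>\<close>
    deciding the turn at \<sigma>. With the \<open>n\<close>-th turn as membership in
    \<open>b n\<close>, the cell of \<sigma> consists of the points whose itinerary begins with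
    \<sigma>.\<close>
  define path where "path x = rec_nat [] (\<lambda>_ \<sigma>. \<sigma> @ [x \<in> U \<sigma>])" for x
  have path0: "path x 0 = []" and pathS: "path x (Suc n) = path x n @ [x \<in> U (path x n)]" for x n
    by (simp_all add: path_def)
  have len: "length (path x n) = n" for x n
    by (induction n) (simp_all add: path0 pathS)
  define b where "b n = {x \<in> topspace X. x \<in> U (path x n)}" for n
  have cell: "cell X b \<sigma> = {x \<in> topspace X. path x (length \<sigma>) = \<sigma>}" for \<sigma>
  proof (induction \<sigma> rule: rev_induct)
    case (snoc e \<sigma>)
    then show ?case
      by (auto simp: cell_snoc pathS b_def)
  qed (simp add: cell_Nil path0)
  have clp: "clopenin X {x \<in> topspace X. path x (length \<sigma>) = \<sigma>}" for \<sigma>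
  proof (induction \<sigma> rule: rev_induct)
    case (snoc e \<sigma>)
    have "{x \<in> topspace X. path x (length (\<sigma> @ [e])) = \<sigma> @ [e]} =
      {x \<in> topspace X. path x (length \<sigma>) = \<sigma>} \<inter> {x \<in> topspace X. (x \<in> U \<sigma>) = e}"
      by (auto simp: pathS)
    then show ?case
      using snoc U by (simp add: clopenin_Int clopenin_Collect_iff)
  qed (simp add: path0 clopenin_topspace)
  have clb: "clopenin X (b n)" for n
  proof -
    have "b n = (\<Union>\<sigma>\<in>{\<sigma>. set \<sigma> \<subseteq> UNIV \<and> length \<sigma> = n}. {x \<in> topspace X. path x (length \<sigma>) = \<sigma>} \<inter> U \<sigma>)"
      using len by (auto simp: b_def)
    moreover have "finite {\<sigma>::bool list. set \<sigma> \<subseteq> UNIV \<and> length \<sigma> = n}"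
      by (rule finite_lists_length_eq) simp
    ultimately show ?thesis
      using clp U by (simp only:) (intro clopenin_Union clopenin_Int; simp only:)
  qed
  have low: "1 / 3 ^ n \<le> r (path x n) x" if x: "x \<in> topspace X" for x n
  proof (induction n)
    case 0
    then show ?case
      by (simp add: path0 rone x)
  next
    case (Suc n)
    let ?e = "x \<in> U (path x n)"
    have "x \<notin> A (path x n) ?e"
      using U(2,3)[of "path x n"] by (cases ?e) auto
    then show ?case
      using Suc x by (auto simp: A_def len pathS)
  qed
  \<comment> \<open>The value 1 passes up to all prefixes of \<sigma>. At each of them the sibling
    has value 0, so the point lies in \<open>A\<close> for the sibling and its turn is
    forced.\<close>
  have high: "path x (length \<sigma>) = \<sigma>" if x: "x \<in> topspace X" and "r \<sigma> x = 1" for x \<sigma>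
    using that(2)
  proof (induction \<sigma> rule: rev_induct)
    case Nil
    then show ?case
      by (simp add: path0)
  next
    case (snoc e \<sigma>)
    have "r (\<sigma> @ [\<not> e]) x = 0 \<and> r \<sigma> x = 1"
      using radd[OF x, of \<sigma>] snoc.prems r0[OF x, of "\<sigma> @ [True]"] r1[OF x, of \<sigma>]
        r0[OF x, of "\<sigma> @ [False]"] by (cases e) simp_all
    then have "path x (length \<sigma>) = \<sigma>" "x \<in> A \<sigma> (\<not> e)"
      using snoc.IH x by (auto simp: A_def)
    then show ?case
      using U(2,3)[of \<sigma>] by (cases e) (auto simp: pathS)
  qed
  show thesis
  proof (rule that[OF clb])
    fix \<sigma> x assume "x \<in> cell X b \<sigma>"
    then have x: "x \<in> topspace X" "path x (length \<sigma>) = \<sigma>"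
      by (auto simp: cell)
    then have "r \<sigma> x > 0"
      using low[OF x(1), of "length \<sigma>"] by (smt (verit) zero_less_divide_1_iff zero_less_power)
    then show "y \<sigma> x \<noteq> 0"
      by (auto simp: r_def)
  next
    fix \<sigma> x assume x: "x \<in> topspace X" and "cmod (1 + y \<sigma> x) = 2"
    then have "(1 + Re (y \<sigma> x))\<^sup>2 + (Im (y \<sigma> x))\<^sup>2 = 4"
      using cmod_power2[of "1 + y \<sigma> x"] by simp
    moreover have "(Re (y \<sigma> x))\<^sup>2 + (Im (y \<sigma> x))\<^sup>2 \<le> 1"
      using le1[OF x, of \<sigma>] by (metis cmod_power2 norm_ge_zero power_le_one)
    \<comment> \<open>Expanding the first square gives \<open>1 + 2 Re y + |y|^2 = 4\<close>, and
      \<open>|y|^2\<close> is at most 1.\<close>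
    ultimately have "1 \<le> Re (y \<sigma> x)"
      by (simp add: power2_sum)
    then have "r \<sigma> x = 1"
      using r1[OF x, of \<sigma>] by (simp add: r_def)
    then show "x \<in> cell X b \<sigma>"
      using high[OF x, of \<sigma>] x by (simp add: cell)
  qed
qed

text \<open>Where \<open>d\<close> holds, the cell of \<tau> has a point of value 1, and this is
  caught in the cell of \<sigma>. Where \<open>d\<close> fails, the martingale vanishes on the cell
  of \<tau>, whereas it has no zero on the cell of \<sigma>.\<close>

lemma realize_pattern:
  fixes d :: "bool list \<Rightarrow> bool list \<Rightarrow> bool"
  assumes "countably_degree1_saturated (CX X)"
    and "\<And>i. clopenin X (G i)"
    and "\<And>N. \<exists>b. (\<forall>i. clopenin X (b i)) \<and>
        (\<forall>\<sigma> \<tau>. length \<sigma> \<le> N \<and> length \<tau> \<le> N \<longrightarrow> (cell X b \<sigma> \<inter> cell X G \<tau> \<noteq> {}) = d \<sigma> \<tau>)"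
  obtains b where "\<And>i. clopenin X (b i)" "\<And>\<sigma> \<tau>. (cell X b \<sigma> \<inter> cell X G \<tau> \<noteq> {}) = d \<sigma> \<tau>"
proof (rule degree1_martingale[OF assms])
  fix y :: "bool list \<Rightarrow> 'a \<Rightarrow> complex"
  assume y: "\<And>\<sigma>. continuous_map X euclidean (y \<sigma>)"
      "\<And>\<sigma> x. x \<in> topspace X \<Longrightarrow> cmod (y \<sigma> x) \<le> 1"
      "\<And>\<sigma> x. x \<in> topspace X \<Longrightarrow> cmod (1 - y \<sigma> x) \<le> 1"
      "\<And>\<sigma> x. x \<in> topspace X \<Longrightarrow> y \<sigma> x = y (\<sigma> @ [True]) x + y (\<sigma> @ [False]) x"
      "\<And>x. x \<in> topspace X \<Longrightarrow> y [] x = 1"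
    and pos: "\<And>\<sigma> \<tau>. d \<sigma> \<tau> \<Longrightarrow> \<exists>x\<in>cell X G \<tau>. cmod (1 + y \<sigma> x) = 2"
    and neg: "\<And>\<sigma> \<tau> x. \<not> d \<sigma> \<tau> \<Longrightarrow> x \<in> cell X G \<tau> \<Longrightarrow> y \<sigma> x = 0"
  show thesis
  proof (rule martingale_cells[OF y])
    fix b assume b: "\<And>i. clopenin X (b i)"
      "\<And>\<sigma> x. x \<in> cell X b \<sigma> \<Longrightarrow> y \<sigma> x \<noteq> 0"
      "\<And>\<sigma> x. x \<in> topspace X \<Longrightarrow> cmod (1 + y \<sigma> x) = 2 \<Longrightarrow> x \<in> cell X b \<sigma>"
    have "(cell X b \<sigma> \<inter> cell X G \<tau> \<noteq> {}) = d \<sigma> \<tau>" for \<sigma> \<tau>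
    proof (cases "d \<sigma> \<tau>")
      case True
      then obtain x where x: "x \<in> cell X G \<tau>" "cmod (1 + y \<sigma> x) = 2"
        using pos by blast
      then have "x \<in> cell X b \<sigma>"
        using b(3) by (simp add: cell_def)
      then show ?thesis
        using True x by blast
    next
      case False
      then show ?thesis
        using neg b(2) by blast
    qed
    with b(1) show thesis
      by (rule that)
  qed
qed

text \<open>One half of a comparison: the joint \<open>N\<close>-bit patterns of \<open>b\<close>
  and \<open>G\<close> that occur also occur for \<open>c\<close> and \<open>G\<close>. Points
  rather than cells are matched, which is the form that the arguments about formulas use.\<close>

definition bits_sim :: "nat \<Rightarrow> (nat \<Rightarrow> 'a set) \<Rightarrow> (nat \<Rightarrow> 'a set) \<Rightarrow> (nat \<Rightarrow> 'a set) \<Rightarrow> bool" where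
  "bits_sim N G b c \<longleftrightarrow>
     (\<forall>x\<in>topspace X. \<exists>y\<in>topspace X. \<forall>i<N. (x \<in> b i \<longleftrightarrow> y \<in> c i) \<and> (x \<in> G i \<longleftrightarrow> y \<in> G i))"

lemma bits_simI:
  assumes "\<And>\<sigma> \<tau>. length \<sigma> = N \<Longrightarrow> length \<tau> = N \<Longrightarrow>
      cell X b \<sigma> \<inter> cell X G \<tau> \<noteq> {} \<Longrightarrow> cell X c \<sigma> \<inter> cell X G \<tau> \<noteq> {}"
  shows "bits_sim N G b c"
  unfolding bits_sim_def
proof
  fix x assume "x \<in> topspace X"
  define \<sigma> \<tau> where "\<sigma> = map (\<lambda>i. x \<in> b i) [0..<N]" and "\<tau> = map (\<lambda>i. x \<in> G i) [0..<N]"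
  have "x \<in> cell X b \<sigma> \<inter> cell X G \<tau>"
    using \<open>x \<in> topspace X\<close> by (simp add: cell_def \<sigma>_def \<tau>_def)
  then obtain y where "y \<in> cell X c \<sigma> \<inter> cell X G \<tau>"
    using assms[of \<sigma> \<tau>] by (auto simp: \<sigma>_def \<tau>_def)
  then show "\<exists>y\<in>topspace X. \<forall>i<N. (x \<in> b i \<longleftrightarrow> y \<in> c i) \<and> (x \<in> G i \<longleftrightarrow> y \<in> G i)"
    by (intro bexI[of _ y]) (auto simp: cell_def \<sigma>_def \<tau>_def)
qed

text \<open>On each finite level the limit pattern \<open>d\<close> recurs at infinitely many
  \<open>m\<close>, so it is finitely approximated and \<open>realize_pattern\<close> applies.
  Arbitrarily late \<open>m\<close> are provided because later members of \<open>c\<close> will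
  satisfy more conditions, or satisfy them better.\<close>

lemma clopen_limit:
  assumes sat: "countably_degree1_saturated (CX X)"
    and G: "\<And>i. clopenin X (G i)"
    and c: "\<And>m i. clopenin X (c m i)"
  obtains b where "\<And>i. clopenin X (b i)"
    "\<And>N. \<exists>m\<ge>N. bits_sim N G b (c m) \<and> bits_sim N G (c m) b"
proof -
  define Q where "Q m k = (case from_nat k of (\<sigma>, \<tau>) \<Rightarrow> cell X (c m) \<sigma> \<inter> cell X G \<tau> \<noteq> {})" for m k
  obtain d0 where d0: "\<And>N. infinite {m. \<forall>k<N. Q m k = d0 k}"
    using infinitely_often_pattern by blast
  define d where "d \<sigma> \<tau> = d0 (to_nat (\<sigma>, \<tau>))" for \<sigma> \<tau> :: "bool list"
  have key: "\<exists>m\<ge>N. \<forall>\<sigma> \<tau>. length \<sigma> \<le> N \<and> length \<tau> \<le> N \<longrightarrow> (cell X (c m) \<sigma> \<inter> cell X G \<tau> \<noteq> {}) = d \<sigma> \<tau>" for N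
  proof -
    define L where "L = {\<sigma>::bool list. set \<sigma> \<subseteq> UNIV \<and> length \<sigma> \<le> N}"
    have "finite L"
      unfolding L_def by (rule finite_lists_length_le) simp
    then have "finite (to_nat ` (L \<times> L))"
      by simp
    then obtain M where M: "\<And>k. k \<in> to_nat ` (L \<times> L) \<Longrightarrow> k < M"
      by (meson finite_nat_set_iff_bounded)
    obtain m where "m \<ge> N" and m: "\<And>k. k < M \<Longrightarrow> Q m k = d0 k"
      using d0[of M] by (auto simp: infinite_nat_iff_unbounded_le)
    have "(cell X (c m) \<sigma> \<inter> cell X G \<tau> \<noteq> {}) = d \<sigma> \<tau>" if "length \<sigma> \<le> N" "length \<tau> \<le> N" for \<sigma> \<tau>
    proof -
      have "to_nat (\<sigma>, \<tau>) < M"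
        using that by (intro M imageI) (simp add: L_def)
      then show ?thesis
        using m[of "to_nat (\<sigma>, \<tau>)"] by (simp add: Q_def d_def)
    qed
    with \<open>m \<ge> N\<close> show ?thesis
      by blast
  qed
  have "\<exists>b. (\<forall>i. clopenin X (b i)) \<and>
      (\<forall>\<sigma> \<tau>. length \<sigma> \<le> N \<and> length \<tau> \<le> N \<longrightarrow> (cell X b \<sigma> \<inter> cell X G \<tau> \<noteq> {}) = d \<sigma> \<tau>)" for N
    using key[of N] c by blast
  then show thesis
  proof (rule realize_pattern[OF sat G])
    fix b assume b: "\<And>i. clopenin X (b i)" "\<And>\<sigma> \<tau>. (cell X b \<sigma> \<inter> cell X G \<tau> \<noteq> {}) = d \<sigma> \<tau>"
    have "\<exists>m\<ge>N. bits_sim N G b (c m) \<and> bits_sim N G (c m) b" for N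
    proof -
      obtain m where "m \<ge> N" and m: "\<And>\<sigma> \<tau>. length \<sigma> \<le> N \<Longrightarrow> length \<tau> \<le> N \<Longrightarrow>
          (cell X (c m) \<sigma> \<inter> cell X G \<tau> \<noteq> {}) = d \<sigma> \<tau>"
        using key[of N] by blast
      then have "bits_sim N G b (c m) \<and> bits_sim N G (c m) b"
        using b(2) by (intro conjI bits_simI) (metis order_refl)+
      with \<open>m \<ge> N\<close> show ?thesis
        by blast
    qed
    with b(1) show thesis
      by (rule that)
  qed
qed

end

subsection \<open>The back-and-forth step\<close>

text \<open>An easy case of Hall's theorem: a finite \<open>V i\<close> has a private point, an
  infinite one always has a point left over. The induction keeps choices from infinite sets away
  from all points \<open>q k\<close>, including those of indices still to come.\<close>

lemma distinct_representatives:
  fixes V :: "'i \<Rightarrow> 'a set"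
  assumes fin: "finite I"
    and alt: "\<And>i. i \<in> I \<Longrightarrow> infinite (V i) \<or> (\<exists>p\<in>V i. \<forall>k\<in>I. k \<noteq> i \<longrightarrow> p \<notin> V k)"
  obtains c where "inj_on c I" "\<And>i. i \<in> I \<Longrightarrow> c i \<in> V i"
proof -
  obtain q where q: "\<And>i. i \<in> I \<Longrightarrow> finite (V i) \<Longrightarrow> q i \<in> V i \<and> (\<forall>k\<in>I. k \<noteq> i \<longrightarrow> q i \<notin> V k)"
    using alt by metis
  have "\<exists>c. inj_on c J \<and> (\<forall>i\<in>J. c i \<in> V i \<and> (if finite (V i) then c i = q i else c i \<notin> q ` I))"
    if "J \<subseteq> I" for J
    using finite_subset[OF that fin] that
  proof (induction J rule: finite_induct)
    case (insert j J)
    have "J \<subseteq> I"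
      using insert.prems by simp
    from insert.IH[OF this] obtain c where inj: "inj_on c J"
      and c: "\<And>i. i \<in> J \<Longrightarrow> c i \<in> V i \<and> (if finite (V i) then c i = q i else c i \<notin> q ` I)"
      by metis
    obtain p where p: "p \<in> V j" "p \<notin> c ` J" "if finite (V j) then p = q j else p \<notin> q ` I"
    proof (cases "finite (V j)")
      case True
      have "q j \<notin> c ` J"
      proof
        assume "q j \<in> c ` J"
        then obtain i where "i \<in> J" "q j = c i"
          by auto
        then show False
          using c[of i] q[of j] True insert.prems insert.hyps by (metis insert_subset subsetD)
      qed
      then show thesis
        using that[of "q j"] True q[of j] insert.prems by simp
    next
      case False
      have "infinite (V j - (c ` J \<union> q ` I))"
        using False insert.hyps fin by (intro Diff_infinite_finite) auto
      then obtain p where "p \<in> V j - (c ` J \<union> q ` I)"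
        using infinite_imp_nonempty by blast
      then show thesis
        using that[of p] False by simp
    qed
    have eq: "(c(j := p)) i = c i" if "i \<in> J" for i
      using that insert.hyps by auto
    have "inj_on (c(j := p)) (insert j J)"
      using inj p(2) insert.hyps by (auto simp: inj_on_def)
    moreover have "\<forall>i\<in>insert j J. (c(j := p)) i \<in> V i \<and>
        (if finite (V i) then (c(j := p)) i = q i else (c(j := p)) i \<notin> q ` I)"
      using c p eq by simp
    ultimately show ?case
      by blast
  qed simp
  then show thesis
    using that by (metis order_refl)
qed

context boolean_space
begin

lemma clopen_shrinking:
  assumes fin: "finite I"
    and opn: "\<And>i. i \<in> I \<Longrightarrow> openin X (V i)"
    and cover: "topspace X \<subseteq> (\<Union>i\<in>I. V i)"
    and c: "inj_on c I" "\<And>i. i \<in> I \<Longrightarrow> c i \<in> V i"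
  obtains w where "\<And>i. clopenin X {x \<in> topspace X. w x = i}"
    "\<And>x. x \<in> topspace X \<Longrightarrow> w x \<in> I \<and> x \<in> V (w x)" "\<And>i. i \<in> I \<Longrightarrow> w (c i) = i"
proof -
  have "\<exists>w. (\<forall>i. clopenin X {x \<in> topspace X. w x = i}) \<and> (\<forall>x\<in>topspace X. w x \<in> I \<and> x \<in> V (w x))"
  proof -
    have "\<exists>U. clopenin X U \<and> x \<in> U \<and> (\<exists>i\<in>I. U \<subseteq> V i)" if "x \<in> topspace X" for x
      using that cover clopen_base opn by (metis UN_E subsetD)
    then obtain U j where U: "\<And>x. x \<in> topspace X \<Longrightarrow> clopenin X (U x) \<and> x \<in> U x \<and> j x \<in> I \<and> U x \<subseteq> V (j x)"
      by metis
    have "\<exists>w. (\<forall>i. clopenin X {x \<in> topspace X. w x = i}) \<and> (\<forall>x\<in>\<Union>(U ` S). w x \<in> I \<and> x \<in> V (w x))"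
      if "finite S" "S \<subseteq> topspace X" for S
      using that
    proof (induction S rule: finite_induct)
      case empty
      \<comment> \<open>Nothing is required off the part covered so far, so a default index is used
        there; only its fibres have to be clopen.\<close>
      have "clopenin X {x \<in> topspace X. undefined = i}" for i :: 'b
        using clopenin_empty clopenin_topspace by (cases "undefined = i") auto
      then show ?case
        by (intro exI[of _ "\<lambda>_. undefined"]) simp
    next
      case (insert s S)
      then obtain w where w: "\<And>i. clopenin X {x \<in> topspace X. w x = i}"
        "\<And>x. x \<in> \<Union>(U ` S) \<Longrightarrow> w x \<in> I \<and> x \<in> V (w x)"
        by (metis insert_subset)
      have "clopenin X {x \<in> topspace X. (if x \<in> U s then j s else w x) = i}" for i
      proof -
        have cl: "clopenin X (U s)"
          using U insert.prems by auto
        have "{x \<in> topspace X. (if x \<in> U s then j s else w x) = i} =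
            (if j s = i then U s else {}) \<union> ({x \<in> topspace X. w x = i} - U s)"
          using clopenin_subset[OF cl] by auto
        then show ?thesis
          using cl w(1) by (auto intro: clopenin_Un clopenin_diff clopenin_empty)
      qed
      moreover have "\<forall>x\<in>\<Union>(U ` insert s S). (if x \<in> U s then j s else w x) \<in> I \<and> x \<in> V (if x \<in> U s then j s else w x)"
        using U[of s] insert.prems w(2) by auto
      ultimately show ?case
        by (intro exI[of _ "\<lambda>x. if x \<in> U s then j s else w x"]) simp
    qed
    moreover have "\<exists>S. finite S \<and> S \<subseteq> topspace X \<and> topspace X \<subseteq> \<Union>(U ` S)"
    proof -
      have "openin X T" if "T \<in> U ` topspace X" for T
        using U that by (auto simp: clopenin_def)
      moreover have "topspace X \<subseteq> \<Union>(U ` topspace X)"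
        using U by blast
      ultimately obtain F where "finite F" "F \<subseteq> U ` topspace X" "topspace X \<subseteq> \<Union>F"
        using compact unfolding compact_space_def by (meson compactinD)
      then show ?thesis
        using finite_subset_image[of F U "topspace X"] by auto
    qed
    ultimately show ?thesis
      by (meson subsetD)
  qed
  then obtain w0 where w0: "\<And>i. clopenin X {x \<in> topspace X. w0 x = i}"
    "\<And>x. x \<in> topspace X \<Longrightarrow> w0 x \<in> I \<and> x \<in> V (w0 x)"
    by blast
  have "\<exists>w. (\<forall>i. clopenin X {x \<in> topspace X. w x = i}) \<and> (\<forall>x\<in>topspace X. w x \<in> I \<and> x \<in> V (w x)) \<and>
      (\<forall>i\<in>J. w (c i) = i)" if "J \<subseteq> I" for J
    using finite_subset[OF that fin] that
  proof (induction J rule: finite_induct)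
    case empty
    then show ?case
      using w0 by blast
  next
    case (insert j J)
    then obtain w where w: "\<And>i. clopenin X {x \<in> topspace X. w x = i}"
      "\<And>x. x \<in> topspace X \<Longrightarrow> w x \<in> I \<and> x \<in> V (w x)" "\<And>i. i \<in> J \<Longrightarrow> w (c i) = i"
      by (metis insert_subset)
    have j: "j \<in> I"
      using insert.prems by simp
    have ctop: "c i \<in> topspace X" if "i \<in> I" for i
      using c(2)[OF that] openin_subset[OF opn[OF that]] by blast
    have "closedin X (\<Union>i\<in>J. {c i})"
      using insert ctop by (intro closedin_Union) (auto intro!: singleton_closed)
    then have "openin X (V j - (\<Union>i\<in>J. {c i}))"
      using opn[OF j] by blast
    moreover have "c j \<in> V j - (\<Union>i\<in>J. {c i})"
    proof -
      have "c j \<noteq> c i" if "i \<in> J" for i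
        using that insert.hyps insert.prems inj_onD[OF c(1)] by blast
      then show ?thesis
        using c(2)[OF j] by auto
    qed
    ultimately obtain O1 where O1: "clopenin X O1" "c j \<in> O1" "O1 \<subseteq> V j - (\<Union>i\<in>J. {c i})"
      by (rule clopen_base)
    have "clopenin X {x \<in> topspace X. (if x \<in> O1 then j else w x) = i}" for i
    proof -
      have "{x \<in> topspace X. (if x \<in> O1 then j else w x) = i} =
          (if j = i then O1 else {}) \<union> ({x \<in> topspace X. w x = i} - O1)"
        using clopenin_subset[OF O1(1)] by auto
      then show ?thesis
        using O1(1) w(1) by (auto intro: clopenin_Un clopenin_diff clopenin_empty)
    qed
    moreover have "\<forall>x\<in>topspace X. (if x \<in> O1 then j else w x) \<in> I \<and> x \<in> V (if x \<in> O1 then j else w x)"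
      using O1 w(2) j by auto
    moreover have "\<forall>i\<in>insert j J. (if c i \<in> O1 then j else w (c i)) = i"
      using O1 w(3) by auto
    ultimately show ?case
      by (intro exI[of _ "\<lambda>x. if x \<in> O1 then j else w x"]) simp
  qed
  then show thesis
    using that by (metis order_refl)
qed

text \<open>One step of the back-and-forth argument: \<open>E i x\<close> says that \<open>x\<close> looks like \<open>i\<close> in the first
  structure, \<open>D i y\<close> that \<open>y\<close> in the second structure looks like \<open>i\<close> in the first. The map \<open>w\<close>
  transports a new element \<open>u\<close> of the first structure to \<open>u \<circ> w\<close>.\<close>

lemma transport:
  fixes D E :: "'a \<Rightarrow> 'a \<Rightarrow> bool"
  assumes E: "\<And>i. i \<in> topspace X \<Longrightarrow> openin X {x \<in> topspace X. E i x}" "\<And>i. i \<in> topspace X \<Longrightarrow> E i i"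
    and D: "\<And>i. i \<in> topspace X \<Longrightarrow> openin X {y \<in> topspace X. D i y}"
      "\<And>i. i \<in> topspace X \<Longrightarrow> \<exists>y\<in>topspace X. D i y"
      "\<And>y. y \<in> topspace X \<Longrightarrow> \<exists>x\<in>topspace X. \<forall>i\<in>topspace X. E i x \<longrightarrow> D i y"
      "\<And>i p. i \<in> topspace X \<Longrightarrow> p \<in> isolated_points X \<Longrightarrow> D i p \<Longrightarrow> i = p"
  obtains w where "\<And>i. clopenin X {x \<in> topspace X. w x = i}" "finite (w ` topspace X)"
    "\<And>y. y \<in> topspace X \<Longrightarrow> w y \<in> topspace X \<and> D (w y) y"
    "\<And>x. x \<in> topspace X \<Longrightarrow> \<exists>y\<in>topspace X. E (w y) x"
proof -
  have "openin X T" if "T \<in> (\<lambda>i. {x \<in> topspace X. E i x}) ` topspace X" for T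
    using E that by auto
  moreover have "topspace X \<subseteq> \<Union>((\<lambda>i. {x \<in> topspace X. E i x}) ` topspace X)"
    using E by blast
  ultimately obtain F where "finite F" "F \<subseteq> (\<lambda>i. {x \<in> topspace X. E i x}) ` topspace X" "topspace X \<subseteq> \<Union>F"
    using compact unfolding compact_space_def by (meson compactinD)
  \<comment> \<open>The points of \<open>I\<close> stand for finitely many types that exhaust the
    first structure.\<close>
  then obtain I where I: "finite I" "I \<subseteq> topspace X" and IE: "\<And>x. x \<in> topspace X \<Longrightarrow> \<exists>i\<in>I. E i x"
    using finite_subset_image by (smt (verit) UN_E mem_Collect_eq subsetD)
  define V where "V i = {y \<in> topspace X. D i y}" for i
  \<comment> \<open>An isolated point of \<open>V i\<close> can only be \<open>i\<close> itself and
    so lies in no other \<open>V k\<close>; if there is none, \<open>V i\<close> is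
    infinite.\<close>
  have alt: "infinite (V i) \<or> (\<exists>p\<in>V i. \<forall>k\<in>I. k \<noteq> i \<longrightarrow> p \<notin> V k)" if i: "i \<in> I" for i
  proof (cases "V i \<inter> isolated_points X = {}")
    case True
    obtain y where "y \<in> V i"
      using D(2)[of i] i I unfolding V_def by blast
    moreover have "openin X (V i)"
      using D(1) i I by (auto simp: V_def)
    ultimately show ?thesis
      using infinite_open True by blast
  next
    case False
    then obtain p where p: "p \<in> V i" "p \<in> isolated_points X"
      by blast
    then have "i = p"
      using D(4) i I by (auto simp: V_def)
    then have "p \<notin> V k" if "k \<in> I" "k \<noteq> i" for k
      using D(4)[of k p] p that I by (auto simp: V_def)
    with p show ?thesis
      by blast
  qed
  obtain c where c: "inj_on c I" "\<And>i. i \<in> I \<Longrightarrow> c i \<in> V i"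
    using distinct_representatives[OF I(1) alt] by blast
  have opn: "openin X (V i)" if "i \<in> I" for i
    using D(1) that I by (auto simp: V_def)
  \<comment> \<open>Each \<open>y\<close> has a counterpart \<open>x\<close> in the first structure,
    and an index in \<open>I\<close> whose type \<open>x\<close> satisfies also fits
    \<open>y\<close>.\<close>
  have cover: "topspace X \<subseteq> (\<Union>i\<in>I. V i)"
  proof
    fix y assume y: "y \<in> topspace X"
    then obtain x where x: "x \<in> topspace X" "\<forall>i\<in>topspace X. E i x \<longrightarrow> D i y"
      using D(3) by blast
    then show "y \<in> (\<Union>i\<in>I. V i)"
      using IE[OF x(1)] I y by (auto simp: V_def)
  qed
  show thesis
  proof (rule clopen_shrinking[OF I(1) opn cover c])
    fix w assume w: "\<And>i. clopenin X {x \<in> topspace X. w x = i}"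
      "\<And>x. x \<in> topspace X \<Longrightarrow> w x \<in> I \<and> x \<in> V (w x)" "\<And>i. i \<in> I \<Longrightarrow> w (c i) = i"
    have "finite (w ` topspace X)"
      using w(2) I(1) by (meson finite_subset image_subsetI)
    \<comment> \<open>The points \<open>c i\<close> make every index of \<open>I\<close> a value of
      \<open>w\<close>, so that no type of the first structure is lost.\<close>
    moreover have "\<exists>y\<in>topspace X. E (w y) x" if x: "x \<in> topspace X" for x
    proof -
      obtain i where i: "i \<in> I" "E i x"
        using IE[OF x] by blast
      then have "c i \<in> topspace X" "E (w (c i)) x"
        using c(2)[OF i(1)] w(3)[OF i(1)] by (auto simp: V_def)
      then show ?thesis
        by blast
    qed
    ultimately show thesis
      using w I by (intro that[of w]) (auto simp: V_def)
  qed
qed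

end

subsection \<open>Saturation of the clopen algebra\<close>

lemma clopenin_Ball:
  assumes "finite P" "\<And>p. p \<in> P \<Longrightarrow> clopenin X {x \<in> topspace X. Q p x}"
  shows "clopenin X {x \<in> topspace X. \<forall>p\<in>P. Q p x}"
  using assms
proof (induction P rule: finite_induct)
  case (insert p P)
  have "{x \<in> topspace X. \<forall>q\<in>insert p P. Q q x} = {x \<in> topspace X. Q p x} \<inter> {x \<in> topspace X. \<forall>q\<in>P. Q q x}"
    by auto
  then show ?case
    using insert by (simp add: clopenin_Int)
qed (simp add: clopenin_topspace)

lemma finite_ba_term_params: "finite (ba_term_params t)"
  by (induction t) auto

lemma finite_ba_params: "finite (ba_params \<phi>)"
  by (induction \<phi>) (auto simp: finite_ba_term_params)

lemma finite_subset_range_bound: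
  fixes g :: "nat \<Rightarrow> 'b"
  assumes "finite P" "P \<subseteq> range g"
  obtains M where "\<And>p. p \<in> P \<Longrightarrow> \<exists>i<M. g i = p"
proof -
  obtain I where I: "finite I" "P = g ` I"
    using finite_subset_image[OF assms] by blast
  then obtain M where "\<forall>i\<in>I. i < M"
    by (meson finite_nat_set_iff_bounded)
  with I show thesis
    using that by blast
qed

lemma CL_carrier: "ba_carrier (CL X) = Collect (clopenin X)"
  by (auto simp: CL_def clopenin_def)

lemma CL_term_clopen:
  assumes "\<And>i. clopenin X (s i)" "\<And>p. p \<in> ba_term_params t \<Longrightarrow> clopenin X p"
  shows "clopenin X (ba_term_val (CL X) s t)"
  using assms(2)
  by (induction t)
    (auto simp: assms(1) CL_def clopenin_empty clopenin_topspace
       intro!: clopenin_Int clopenin_Un clopenin_diff)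

primrec ba_var_bound :: "'b ba_term \<Rightarrow> nat" where
  "ba_var_bound (BVar i) = Suc i"
| "ba_var_bound (BPar a) = 0"
| "ba_var_bound BBot = 0"
| "ba_var_bound BTop = 0"
| "ba_var_bound (BInf t u) = max (ba_var_bound t) (ba_var_bound u)"
| "ba_var_bound (BSup t u) = max (ba_var_bound t) (ba_var_bound u)"
| "ba_var_bound (BCompl t) = ba_var_bound t"

lemma CL_term_pointwise:
  assumes "x \<in> topspace X" "y \<in> topspace X"
    and "\<And>i. i < ba_var_bound \<tau> \<Longrightarrow> x \<in> s i \<longleftrightarrow> y \<in> t i"
    and "\<And>p. p \<in> ba_term_params \<tau> \<Longrightarrow> x \<in> p \<longleftrightarrow> y \<in> p"
  shows "x \<in> ba_term_val (CL X) s \<tau> \<longleftrightarrow> y \<in> ba_term_val (CL X) t \<tau>"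
  using assms(3,4) by (induction \<tau>) (simp_all add: CL_def assms(1,2))

context boolean_space
begin

text \<open>One direction only, like \<open>bits_sim\<close>; but \<open>N\<close> limits the
  variables alone, and all sets in \<open>P\<close> are compared.\<close>

definition ba_sim :: "'a set set \<Rightarrow> nat \<Rightarrow> (nat \<Rightarrow> 'a set) \<Rightarrow> (nat \<Rightarrow> 'a set) \<Rightarrow> bool" where
  "ba_sim P N s t \<longleftrightarrow>
     (\<forall>x\<in>topspace X. \<exists>y\<in>topspace X. (\<forall>i<N. x \<in> s i \<longleftrightarrow> y \<in> t i) \<and> (\<forall>p\<in>P. x \<in> p \<longleftrightarrow> y \<in> p))"

lemma ba_sim_mono: "ba_sim P N s t \<Longrightarrow> M \<le> N \<Longrightarrow> ba_sim P M s t"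
  unfolding ba_sim_def by (meson less_le_trans)

text \<open>The level \<open>N\<close> is preserved. By \<open>iso\<close> the singletons of
  isolated points belong to every type, so an isolated point can only be matched with
  itself.\<close>

lemma ba_sim_extend:
  assumes P: "finite P" "\<And>p. p \<in> P \<Longrightarrow> clopenin X p"
    and iso: "\<And>p. p \<in> isolated_points X \<Longrightarrow> {p} \<in> P"
    and s: "\<And>i. clopenin X (s i)" and t: "\<And>i. clopenin X (t i)"
    and sim: "ba_sim P N s t" "ba_sim P N t s"
    and u: "clopenin X u"
  obtains v where "clopenin X v" "ba_sim P N (s(k := u)) (t(k := v))" "ba_sim P N (t(k := v)) (s(k := u))"
proof -
  define E where "E i x \<longleftrightarrow> (\<forall>j<N. (x \<in> s j) = (i \<in> s j)) \<and> (\<forall>p\<in>P. (x \<in> p) = (i \<in> p)) \<and> (x \<in> u) = (i \<in> u)" for i x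
  \<comment> \<open>\<open>u\<close> is left out, since its counterpart \<open>v\<close> is obtained
    from \<open>w\<close> only afterwards, as the set of points that \<open>w\<close> sends into
    \<open>u\<close>.\<close>
  define D where "D i y \<longleftrightarrow> (\<forall>j<N. (y \<in> t j) = (i \<in> s j)) \<and> (\<forall>p\<in>P. (y \<in> p) = (i \<in> p))" for i y
  have clP: "clopenin X {x \<in> topspace X. \<forall>p\<in>P. (x \<in> p) = (i \<in> p)}" for i
    by (intro clopenin_Ball P clopenin_Collect_iff)
  have "clopenin X {x \<in> topspace X. D i x}" for i
  proof -
    have "{x \<in> topspace X. D i x} = {x \<in> topspace X. \<forall>j<N. (x \<in> t j) = (i \<in> s j)} \<inter>
        {x \<in> topspace X. \<forall>p\<in>P. (x \<in> p) = (i \<in> p)}"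
      by (auto simp: D_def)
    then show ?thesis
      using clP by (simp only:) (intro clopenin_Int clopenin_agree t; simp)
  qed
  then have D1: "openin X {x \<in> topspace X. D i x}" for i
    by (simp add: clopenin_def)
  have "clopenin X {x \<in> topspace X. E i x}" for i
  proof -
    have "{x \<in> topspace X. E i x} = {x \<in> topspace X. \<forall>j<N. (x \<in> s j) = (i \<in> s j)} \<inter>
        ({x \<in> topspace X. \<forall>p\<in>P. (x \<in> p) = (i \<in> p)} \<inter> {x \<in> topspace X. (x \<in> u) = (i \<in> u)})"
      by (auto simp: E_def)
    then show ?thesis
      using clP by (simp only:) (intro clopenin_Int clopenin_agree s clopenin_Collect_iff u; simp)
  qed
  then have E1: "openin X {x \<in> topspace X. E i x}" for i
    by (simp add: clopenin_def)
  have E2: "E i i" for i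
    by (simp add: E_def)
  have D2: "\<exists>y\<in>topspace X. D i y" if i: "i \<in> topspace X" for i
  proof -
    obtain y where "y \<in> topspace X" "\<forall>j<N. (i \<in> s j) = (y \<in> t j)" "\<forall>p\<in>P. (i \<in> p) = (y \<in> p)"
      using sim(1) i unfolding ba_sim_def by blast
    then show ?thesis
      by (intro bexI[of _ y]) (auto simp: D_def)
  qed
  have D3: "\<exists>x\<in>topspace X. \<forall>i\<in>topspace X. E i x \<longrightarrow> D i y" if y: "y \<in> topspace X" for y
  proof -
    obtain x where "x \<in> topspace X" "\<forall>j<N. (y \<in> t j) = (x \<in> s j)" "\<forall>p\<in>P. (y \<in> p) = (x \<in> p)"
      using sim(2) y unfolding ba_sim_def by blast
    then show ?thesis
      by (intro bexI[of _ x]) (auto simp: D_def E_def)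
  qed
  have D4: "i = p" if "i \<in> topspace X" "p \<in> isolated_points X" "D i p" for i p
    using iso that by (force simp: D_def)
  show thesis
  proof (rule transport[of E D, OF E1 E2 D1 D2 D3 D4])
    fix w assume w: "\<And>i. clopenin X {x \<in> topspace X. w x = i}" "finite (w ` topspace X)"
      "\<And>y. y \<in> topspace X \<Longrightarrow> w y \<in> topspace X \<and> D (w y) y"
      "\<And>x. x \<in> topspace X \<Longrightarrow> \<exists>y\<in>topspace X. E (w y) x"
    define v where "v = {y \<in> topspace X. w y \<in> u}"
    have "v = (\<Union>i\<in>w ` topspace X \<inter> u. {x \<in> topspace X. w x = i})"
      by (auto simp: v_def)
    then have "clopenin X v"
      using w by (simp only:) (intro clopenin_Union; simp)
    moreover have "ba_sim P N (s(k := u)) (t(k := v))"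
      unfolding ba_sim_def
    proof
      fix x assume "x \<in> topspace X"
      then obtain y where "y \<in> topspace X" "E (w y) x"
        using w(4) by blast
      moreover from this have "D (w y) y"
        using w(3) by blast
      ultimately show "\<exists>y\<in>topspace X. (\<forall>i<N. x \<in> (s(k := u)) i \<longleftrightarrow> y \<in> (t(k := v)) i) \<and> (\<forall>p\<in>P. x \<in> p \<longleftrightarrow> y \<in> p)"
        by (intro bexI[of _ y]) (auto simp: D_def E_def v_def)
    qed
    moreover have "ba_sim P N (t(k := v)) (s(k := u))"
      unfolding ba_sim_def
    proof
      fix y assume "y \<in> topspace X"
      then show "\<exists>x\<in>topspace X. (\<forall>i<N. y \<in> (t(k := v)) i \<longleftrightarrow> x \<in> (s(k := u)) i) \<and> (\<forall>p\<in>P. y \<in> p \<longleftrightarrow> x \<in> p)"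
        using w(3)[of y] by (intro bexI[of _ "w y"]) (auto simp: D_def v_def)
    qed
    ultimately show thesis
      by (rule that)
  qed
qed

text \<open>As \<open>ba_sim_extend\<close> keeps the level, a quantifier is passed with the
  \<open>N\<close> of its body, and \<open>N\<close> only has to cover the variables of the
  equations. An equation between terms is a pointwise statement and is carried over by matched
  points.\<close>

lemma ba_sat_invariant:
  assumes P: "finite P" "\<And>p. p \<in> P \<Longrightarrow> clopenin X p"
    and iso: "\<And>p. p \<in> isolated_points X \<Longrightarrow> {p} \<in> P"
  shows "ba_params \<phi> \<subseteq> P \<Longrightarrow> \<exists>N. \<forall>s t. (\<forall>i. clopenin X (s i) \<and> clopenin X (t i)) \<and>
      ba_sim P N s t \<and> ba_sim P N t s \<longrightarrow> (ba_sat (CL X) s \<phi> \<longleftrightarrow> ba_sat (CL X) t \<phi>)"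
proof (induction \<phi>)
  case (BEq \<tau>1 \<tau>2)
  let ?N = "max (ba_var_bound \<tau>1) (ba_var_bound \<tau>2)"
  have half: "ba_sat (CL X) s (BEq \<tau>1 \<tau>2)"
    if s: "\<And>i. clopenin X (s i)" and sim: "ba_sim P ?N s t" and eq: "ba_sat (CL X) t (BEq \<tau>1 \<tau>2)" for s t
  proof -
    have sub: "ba_term_val (CL X) s \<tau>1 \<subseteq> topspace X" "ba_term_val (CL X) s \<tau>2 \<subseteq> topspace X"
      using BEq P s by (auto intro!: clopenin_subset CL_term_clopen)
    have "x \<in> ba_term_val (CL X) s \<tau>1 \<longleftrightarrow> x \<in> ba_term_val (CL X) s \<tau>2" if x: "x \<in> topspace X" for x
    proof -
      obtain y where y: "y \<in> topspace X" "\<forall>i<?N. x \<in> s i \<longleftrightarrow> y \<in> t i" "\<forall>p\<in>P. x \<in> p \<longleftrightarrow> y \<in> p"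
        using sim x unfolding ba_sim_def by blast
      have "x \<in> ba_term_val (CL X) s \<tau>1 \<longleftrightarrow> y \<in> ba_term_val (CL X) t \<tau>1"
        using y BEq by (intro CL_term_pointwise x) auto
      moreover have "x \<in> ba_term_val (CL X) s \<tau>2 \<longleftrightarrow> y \<in> ba_term_val (CL X) t \<tau>2"
        using y BEq by (intro CL_term_pointwise x) auto
      ultimately show ?thesis
        using eq by simp
    qed
    with sub show ?thesis
      by auto
  qed
  then show ?case
    by (intro exI[of _ ?N]) blast
next
  case (BNeg \<phi>)
  then show ?case
    by simp
next
  case (BConj \<phi> \<psi>)
  then obtain N1 N2 where
    "\<forall>s t. (\<forall>i. clopenin X (s i) \<and> clopenin X (t i)) \<and>
      ba_sim P N1 s t \<and> ba_sim P N1 t s \<longrightarrow> (ba_sat (CL X) s \<phi> \<longleftrightarrow> ba_sat (CL X) t \<phi>)"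
    "\<forall>s t. (\<forall>i. clopenin X (s i) \<and> clopenin X (t i)) \<and>
      ba_sim P N2 s t \<and> ba_sim P N2 t s \<longrightarrow> (ba_sat (CL X) s \<psi> \<longleftrightarrow> ba_sat (CL X) t \<psi>)"
    by auto
  then show ?case
    by (intro exI[of _ "max N1 N2"]) (metis ba_sat.simps(3) ba_sim_mono max.cobounded1 max.cobounded2)
next
  case (BDisj \<phi> \<psi>)
  then obtain N1 N2 where
    "\<forall>s t. (\<forall>i. clopenin X (s i) \<and> clopenin X (t i)) \<and>
      ba_sim P N1 s t \<and> ba_sim P N1 t s \<longrightarrow> (ba_sat (CL X) s \<phi> \<longleftrightarrow> ba_sat (CL X) t \<phi>)"
    "\<forall>s t. (\<forall>i. clopenin X (s i) \<and> clopenin X (t i)) \<and>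
      ba_sim P N2 s t \<and> ba_sim P N2 t s \<longrightarrow> (ba_sat (CL X) s \<psi> \<longleftrightarrow> ba_sat (CL X) t \<psi>)"
    by auto
  then show ?case
    by (intro exI[of _ "max N1 N2"]) (metis ba_sat.simps(4) ba_sim_mono max.cobounded1 max.cobounded2)
next
  case (BEx k \<phi>)
  then obtain N where N: "\<And>s t. (\<forall>i. clopenin X (s i) \<and> clopenin X (t i)) \<Longrightarrow>
      ba_sim P N s t \<Longrightarrow> ba_sim P N t s \<Longrightarrow> (ba_sat (CL X) s \<phi> \<longleftrightarrow> ba_sat (CL X) t \<phi>)"
    by (metis ba_form.set(5,6))
  have half: "ba_sat (CL X) t (BEx k \<phi>)"
    if cl: "\<And>i. clopenin X (s i)" "\<And>i. clopenin X (t i)" and sim: "ba_sim P N s t" "ba_sim P N t s"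
      and sat: "ba_sat (CL X) s (BEx k \<phi>)" for s t
  proof -
    obtain u where u: "clopenin X u" "ba_sat (CL X) (s(k := u)) \<phi>"
      using sat by (auto simp: CL_carrier)
    show ?thesis
    proof (rule ba_sim_extend[OF P iso cl sim u(1)])
      fix v assume v: "clopenin X v" "ba_sim P N (s(k := u)) (t(k := v))" "ba_sim P N (t(k := v)) (s(k := u))"
      have "ba_sat (CL X) (t(k := v)) \<phi>"
        using N[OF _ v(2,3)] u v(1) cl by simp
      then show ?thesis
        using v(1) by (auto simp: CL_carrier)
    qed
  qed
  then show ?case
    by (intro exI[of _ N]) blast
next
  case (BAll k \<phi>)
  then obtain N where N: "\<And>s t. (\<forall>i. clopenin X (s i) \<and> clopenin X (t i)) \<Longrightarrow>
      ba_sim P N s t \<Longrightarrow> ba_sim P N t s \<Longrightarrow> (ba_sat (CL X) s \<phi> \<longleftrightarrow> ba_sat (CL X) t \<phi>)"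
    by (metis ba_form.set(5,6))
  have half: "ba_sat (CL X) s (BAll k \<phi>)"
    if cl: "\<And>i. clopenin X (s i)" "\<And>i. clopenin X (t i)" and sim: "ba_sim P N s t" "ba_sim P N t s"
      and sat: "ba_sat (CL X) t (BAll k \<phi>)" for s t
  proof -
    have "ba_sat (CL X) (s(k := u)) \<phi>" if u: "clopenin X u" for u
    proof (rule ba_sim_extend[OF P iso cl sim u(1)])
      fix v assume v: "clopenin X v" "ba_sim P N (s(k := u)) (t(k := v))" "ba_sim P N (t(k := v)) (s(k := u))"
      then have "ba_sat (CL X) (t(k := v)) \<phi>"
        using sat by (simp add: CL_carrier)
      then show ?thesis
        using N[OF _ v(2,3)] u v(1) cl by simp
    qed
    then show ?thesis
      by (simp add: CL_carrier)
  qed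
  then show ?case
    by (intro exI[of _ N]) blast
qed

text \<open>Assignments satisfying longer and longer initial parts of the type have a limit in the
  sense of \<open>clopen_limit\<close>; invariance transfers each formula from a late assignment to
  the limit.\<close>

theorem CL_saturated:
  assumes sat: "countably_degree1_saturated (CX X)" and fin: "finite (isolated_points X)"
  shows "ba_countably_saturated (CL X)"
  unfolding ba_countably_saturated_def
proof (intro allI impI, elim conjE)
  fix T :: "'a set ba_form set"
  assume T: "countable T" "\<forall>\<phi>\<in>T. ba_params \<phi> \<subseteq> ba_carrier (CL X)"
    and fsat: "\<forall>F. finite F \<and> F \<subseteq> T \<longrightarrow> ba_realized (CL X) F"
  show "ba_realized (CL X) T"
  \<comment> \<open>The enumeration of \<open>T\<close> requires a nonempty set; the empty type is a
    finite subtype of itself.\<close>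
  proof (cases "T = {}")
    case True
    then show ?thesis
      using fsat by blast
  next
    case False
    define \<psi> where "\<psi> = from_nat_into T"
    have \<psi>: "range \<psi> = T"
      unfolding \<psi>_def using False T(1) by (rule range_from_nat_into)
    \<comment> \<open>There are finitely many isolated points, so their singletons can be added to
      the parameters of every single formula. In \<open>Q\<close> the member
      \<open>topspace X\<close> ensures that there is something to enumerate.\<close>
    define S where "S = (\<lambda>p. {p}) ` isolated_points X"
    define Q where "Q = insert (topspace X) (S \<union> (\<Union>\<phi>\<in>T. ba_params \<phi>))"
    have Scl: "clopenin X p" if "p \<in> S" for p
      using that singleton_closed by (auto simp: S_def isolated_points_def clopenin_def)
    have finS: "finite S"
      using fin by (simp add: S_def)
    have "countable Q"
      unfolding Q_def using T(1) finS finite_ba_params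
      by (intro countable_insert countable_Un countable_UN) (auto intro: countable_finite)
    define G where "G = from_nat_into Q"
    have G: "range G = Q"
      unfolding G_def using \<open>countable Q\<close> by (intro range_from_nat_into) (auto simp: Q_def)
    have Qcl: "clopenin X p" if "p \<in> Q" for p
      using that T(2) Scl by (auto simp: Q_def clopenin_topspace CL_carrier)
    then have Gcl: "clopenin X (G i)" for i
      using G by auto
    have "\<exists>s. (\<forall>i. clopenin X (s i)) \<and> (\<forall>n\<le>m. ba_sat (CL X) s (\<psi> n))" for m
    proof -
      have "ba_realized (CL X) (\<psi> ` {..m})"
        using fsat \<psi> by blast
      then show ?thesis
        by (auto simp: ba_realized_def CL_carrier image_subset_iff)
    qed
    then obtain c where c: "\<And>m i. clopenin X (c m i)" "\<And>m n. n \<le> m \<Longrightarrow> ba_sat (CL X) (c m) (\<psi> n)"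
      by metis
    show ?thesis
    proof (rule clopen_limit[OF sat Gcl c(1)])
      fix b assume b: "\<And>i. clopenin X (b i)" "\<And>N. \<exists>m\<ge>N. bits_sim N G b (c m) \<and> bits_sim N G (c m) b"
      have "ba_sat (CL X) b (\<psi> n)" for n
      proof -
        define P where "P = S \<union> ba_params (\<psi> n)"
        have PQ: "P \<subseteq> Q"
          using \<psi> by (auto simp: P_def Q_def)
        have P: "finite P" "\<And>p. p \<in> P \<Longrightarrow> clopenin X p" "\<And>p. p \<in> isolated_points X \<Longrightarrow> {p} \<in> P" "ba_params (\<psi> n) \<subseteq> P"
          using finS PQ Qcl finite_ba_params by (auto simp: P_def S_def)
        obtain N where N: "\<And>s t. (\<forall>i. clopenin X (s i) \<and> clopenin X (t i)) \<Longrightarrow>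
            ba_sim P N s t \<Longrightarrow> ba_sim P N t s \<Longrightarrow> (ba_sat (CL X) s (\<psi> n) \<longleftrightarrow> ba_sat (CL X) t (\<psi> n))"
          using ba_sat_invariant[OF P] by metis
        have "P \<subseteq> range G"
          using PQ G by simp
        then obtain M where M: "\<And>p. p \<in> P \<Longrightarrow> \<exists>i<M. G i = p"
          using finite_subset_range_bound[OF P(1)] by metis
        \<comment> \<open>\<open>n\<close> makes \<psi> \<open>n\<close> hold for
          \<open>c m\<close>, \<open>N\<close> covers the variables, and \<open>M\<close> covers the
          positions of the parameters in \<open>G\<close>.\<close>
        define L where "L = max n (max N M)"
        obtain m where m: "m \<ge> L" "bits_sim L G b (c m)" "bits_sim L G (c m) b"
          using b(2) by blast
        have sim: "ba_sim P N s t" if st: "bits_sim L G s t" for s t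
          unfolding ba_sim_def
        proof
          fix x assume "x \<in> topspace X"
          then obtain y where y: "y \<in> topspace X" "\<forall>i<L. (x \<in> s i \<longleftrightarrow> y \<in> t i) \<and> (x \<in> G i \<longleftrightarrow> y \<in> G i)"
            using st unfolding bits_sim_def by blast
          have "x \<in> p \<longleftrightarrow> y \<in> p" if p: "p \<in> P" for p
          proof -
            obtain i where "i < M" "G i = p"
              using M[OF p] by blast
            then show ?thesis
              using y(2) by (auto simp: L_def)
          qed
          then show "\<exists>y\<in>topspace X. (\<forall>i<N. x \<in> s i \<longleftrightarrow> y \<in> t i) \<and> (\<forall>p\<in>P. x \<in> p \<longleftrightarrow> y \<in> p)"
            using y by (intro bexI[of _ y]) (auto simp: L_def)
        qed
        have "ba_sat (CL X) (c m) (\<psi> n)"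
          using c(2) m(1) by (simp add: L_def)
        then show ?thesis
          using N[OF _ sim[OF m(2)] sim[OF m(3)]] b(1) c(1) by simp
      qed
      then show ?thesis
        unfolding ba_realized_def using b(1) \<psi> by (intro exI[of _ b]) (auto simp: CL_carrier)
    qed
  qed
qed

end

subsection \<open>Uniform continuity of formulas\<close>

text \<open>Boxes in the sequence model of n-space. They are compact by Tychonoff's theorem, so
  connectives are bounded and uniformly continuous on them.\<close>

definition cube :: "nat \<Rightarrow> real \<Rightarrow> (nat \<Rightarrow> real) set" where
  "cube n M = {a. (\<forall>i<n. \<bar>a i\<bar> \<le> M) \<and> (\<forall>i\<ge>n. a i = 0)}"

lemma compact_cube: "compact (cube n M)"
proof -
  have "cube n M = PiE UNIV (\<lambda>i. if i < n then {-M..M} else {0})"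
    by (auto simp: cube_def PiE_def Pi_def abs_le_iff not_less split: if_splits)
  then have "compactin (product_topology (\<lambda>i::nat. euclideanreal) UNIV) (cube n M)"
    by (simp add: compactin_PiE)
  then show ?thesis
    by (simp add: euclidean_product_topology)
qed

lemma continuous_on_cube:
  assumes "continuous_map (Euclidean_space n) euclideanreal u"
  shows "continuous_on (cube n M) u"
proof -
  have "continuous_map (subtopology (powertop_real UNIV) (cube n M)) euclideanreal u"
    using assms unfolding Euclidean_space_def
    by (rule continuous_map_from_subtopology_mono) (auto simp: cube_def)
  then show ?thesis
    by (simp add: euclidean_product_topology)
qed

text \<open>The metric on sequences weights the coordinates by powers of 1/2, whose sum is
  2.\<close>

lemma dist_fun_le:
  fixes a b :: "nat \<Rightarrow> real"
  assumes "\<And>i. \<bar>a i - b i\<bar> \<le> d"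
  shows "dist a b \<le> 2 * d"
proof -
  have s: "summable (\<lambda>n. (1/2::real) ^ n * d)"
    by (intro summable_mult2 summable_geometric) simp
  have le: "(1/2) ^ n * min (dist (a (from_nat n)) (b (from_nat n))) 1 \<le> (1/2) ^ n * d" for n
    using assms[of "from_nat n"] by (intro mult_left_mono) (auto simp: dist_real_def)
  have "summable (\<lambda>n. (1/2) ^ n * min (dist (a (from_nat n)) (b (from_nat n))) 1)"
    by (rule summable_comparison_test'[OF s, of 0]) (use le in auto)
  then have "dist a b \<le> (\<Sum>n. (1/2) ^ n * d)"
    unfolding dist_fun_def using le s by (intro suminf_le) auto
  also have "\<dots> = 2 * d"
    using suminf_mult2[of "\<lambda>n. (1/2::real) ^ n" d] by (simp add: suminf_geometric summable_geometric)
  finally show ?thesis .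
qed

lemma cube_bounded:
  assumes "continuous_map (Euclidean_space n) euclideanreal u"
  obtains B where "\<And>a. a \<in> cube n M \<Longrightarrow> \<bar>u a\<bar> \<le> B"
proof -
  have "bounded (u ` cube n M)"
    using compact_continuous_image[OF continuous_on_cube[OF assms] compact_cube] by (rule compact_imp_bounded)
  then show thesis
    using that by (auto simp: bounded_iff)
qed

lemma cube_uniformly_continuous:
  assumes "continuous_map (Euclidean_space n) euclideanreal u" "0 < e"
  obtains d where "0 < d" "\<And>a b. a \<in> cube n M \<Longrightarrow> b \<in> cube n M \<Longrightarrow> (\<And>i. i < n \<Longrightarrow> \<bar>a i - b i\<bar> \<le> d) \<Longrightarrow> \<bar>u a - u b\<bar> \<le> e"
proof -
  have "uniformly_continuous_on (cube n M) u"
    by (rule compact_uniformly_continuous[OF continuous_on_cube[OF assms(1)] compact_cube])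
  then obtain d where d: "0 < d" "\<And>a b. a \<in> cube n M \<Longrightarrow> b \<in> cube n M \<Longrightarrow> dist a b < d \<Longrightarrow> dist (u a) (u b) < e"
    unfolding uniformly_continuous_on_def using assms(2) by metis
  show thesis
  proof (rule that[of "d / 3"])
    fix a b assume ab: "a \<in> cube n M" "b \<in> cube n M" "\<And>i. i < n \<Longrightarrow> \<bar>a i - b i\<bar> \<le> d / 3"
    have "\<bar>a i - b i\<bar> \<le> d / 3" for i
      using ab d(1) by (cases "i < n") (auto simp: cube_def)
    then have "dist a b \<le> 2 * (d / 3)"
      by (rule dist_fun_le)
    then have "dist (u a) (u b) < e"
      using d ab by (intro d(2)) auto
    then show "\<bar>u a - u b\<bar> \<le> e"
      by (simp add: dist_real_def)
  qed (use d in simp)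
qed

lemma cSUP_le_add:
  fixes F G :: "'b \<Rightarrow> real"
  assumes "S \<noteq> {}" "bdd_above (G ` S)" "\<And>y. y \<in> S \<Longrightarrow> \<exists>z\<in>S. \<bar>F y - G z\<bar> \<le> e"
  shows "(SUP y\<in>S. F y) \<le> (SUP z\<in>S. G z) + e"
proof (rule cSUP_least[OF assms(1)])
  fix y assume "y \<in> S"
  then obtain z where z: "z \<in> S" "\<bar>F y - G z\<bar> \<le> e"
    using assms(3) by blast
  then have "G z \<le> (SUP z\<in>S. G z)"
    using assms(2) by (intro cSUP_upper)
  then show "F y \<le> (SUP z\<in>S. G z) + e"
    using z by linarith
qed

lemma cINF_le_add:
  fixes F G :: "'b \<Rightarrow> real"
  assumes "S \<noteq> {}" "bdd_below (G ` S)" "\<And>y. y \<in> S \<Longrightarrow> \<exists>z\<in>S. \<bar>F y - G z\<bar> \<le> e"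
  shows "(INF z\<in>S. G z) - e \<le> (INF y\<in>S. F y)"
proof (rule cINF_greatest[OF assms(1)])
  fix y assume "y \<in> S"
  then obtain z where z: "z \<in> S" "\<bar>F y - G z\<bar> \<le> e"
    using assms(3) by blast
  then have "(INF z\<in>S. G z) \<le> G z"
    using assms(2) by (intro cINF_lower)
  then show "(INF z\<in>S. G z) - e \<le> F y"
    using z by linarith
qed

section \<open>Star-polynomials and formulas under approximation of joint images\<close>

lemma finite_sp_params: "finite (sp_params p)"
  by (induction p) auto

lemma finite_cf_params: "finite (cf_params \<phi>)"
  by (induction \<phi>) (auto simp: finite_sp_params)

text \<open>A single index \<open>n\<close> says both how many variables are compared and how
  finely, so a larger \<open>n\<close> is stronger in both respects. All of \<open>P\<close> is
  compared at every level.\<close>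

definition close :: "('a \<Rightarrow> complex) set \<Rightarrow> nat \<Rightarrow> (nat \<Rightarrow> 'a \<Rightarrow> complex) \<Rightarrow> (nat \<Rightarrow> 'a \<Rightarrow> complex) \<Rightarrow> 'a \<Rightarrow> 'a \<Rightarrow> bool" where
  "close P n f g x y \<longleftrightarrow>
     (\<forall>i<n. cmod (f i x - g i y) \<le> 1 / (real n + 1)) \<and> (\<forall>p\<in>P. cmod (p x - p y) \<le> 1 / (real n + 1))"

lemma close_mono: "close P n f g x y \<Longrightarrow> m \<le> n \<Longrightarrow> close P m f g x y"
proof -
  assume c: "close P n f g x y" and "m \<le> n"
  have "1 / (real n + 1) \<le> 1 / (real m + 1)"
    using \<open>m \<le> n\<close> by (intro divide_left_mono) auto
  then show ?thesis
    using c \<open>m \<le> n\<close> unfolding close_def by (meson less_le_trans order_trans)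
qed

lemma close_subset: "close P n f g x y \<Longrightarrow> Q \<subseteq> P \<Longrightarrow> close Q n f g x y"
  by (auto simp: close_def)

lemma small_reciprocal:
  assumes "0 < (e::real)" obtains n where "1 / (real n + 1) \<le> e" "k \<le> n"
proof -
  obtain m where m: "inverse (real (Suc m)) < e"
    using reals_Archimedean assms by blast
  have "1 / (real (max m k) + 1) \<le> 1 / (real m + 1)"
    by (intro divide_left_mono) auto
  also have "\<dots> \<le> e"
    using m by (simp add: inverse_eq_divide add.commute)
  finally show thesis
    using that by simp
qed

context boolean_space
begin

text \<open>Quantifiers range over balls of any radius, so the radius \<open>R\<close> has to grow
  when a quantifier is entered.\<close>

definition assignments :: "real \<Rightarrow> (nat \<Rightarrow> 'a \<Rightarrow> complex) set" where
  "assignments R = {f. range f \<subseteq> cs_ball (CX X) R}"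

lemma assignments_update:
  assumes "f \<in> assignments R" "y \<in> cs_ball (CX X) r"
  shows "f(k := y) \<in> assignments (max R r)"
  using assms cs_ball_mono[of R "max R r" "CX X"] cs_ball_mono[of r "max R r" "CX X"]
  by (auto simp: assignments_def subset_iff image_iff)

lemma sp_val_bounded:
  assumes "sp_params p \<subseteq> cs_ball (CX X) 1"
  shows "\<exists>M\<ge>0. \<forall>f\<in>assignments R. \<forall>x\<in>topspace X. cmod (sp_val (CX X) f p x) \<le> M"
  using assms
proof (induction p)
  case (SVar i)
  show ?case
    by (intro exI[of _ "max R 0"]) (auto simp: assignments_def mem_CX_ball image_subset_iff le_max_iff_disj)
next
  case (SPar a)
  then show ?case
    by (intro exI[of _ 1]) (auto simp: mem_CX_ball)
next
  case (SAdd p q)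
  then obtain M N where "0 \<le> M" "\<forall>f\<in>assignments R. \<forall>x\<in>topspace X. cmod (sp_val (CX X) f p x) \<le> M"
    "0 \<le> N" "\<forall>f\<in>assignments R. \<forall>x\<in>topspace X. cmod (sp_val (CX X) f q x) \<le> N"
    by (metis le_sup_iff starpoly.set(3))
  then show ?case
    by (intro exI[of _ "M + N"]) (auto simp: CX_sels intro: norm_triangle_mono)
next
  case (SMult p q)
  then obtain M N where "0 \<le> M" "\<forall>f\<in>assignments R. \<forall>x\<in>topspace X. cmod (sp_val (CX X) f p x) \<le> M"
    "0 \<le> N" "\<forall>f\<in>assignments R. \<forall>x\<in>topspace X. cmod (sp_val (CX X) f q x) \<le> N"
    by (metis le_sup_iff starpoly.set(4))
  then show ?case
    by (intro exI[of _ "M * N"]) (auto simp: CX_sels norm_mult intro: mult_mono)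
next
  case (SScale c p)
  then obtain M where "0 \<le> M" "\<forall>f\<in>assignments R. \<forall>x\<in>topspace X. cmod (sp_val (CX X) f p x) \<le> M"
    by (metis starpoly.set(5))
  then show ?case
    by (intro exI[of _ "cmod c * M"]) (auto simp: CX_sels norm_mult intro: mult_left_mono)
next
  case (SStar p)
  then show ?case
    by (simp add: CX_sels)
qed

text \<open>Values at two different points are compared, as only joint images matter. Multiplication
  is uniformly continuous on bounded sets, whence the radius \<open>R\<close> and
  \<open>sp_val_bounded\<close>.\<close>

lemma sp_val_close:
  assumes "sp_params p \<subseteq> cs_ball (CX X) 1" "0 < e"
  shows "\<exists>n. \<forall>f\<in>assignments R. \<forall>g\<in>assignments R. \<forall>x\<in>topspace X. \<forall>y\<in>topspace X.
      close (sp_params p) n f g x y \<longrightarrow> cmod (sp_val (CX X) f p x - sp_val (CX X) g p y) \<le> e"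
  using assms
proof (induction p arbitrary: e)
  case (SVar i)
  obtain n where "1 / (real n + 1) \<le> e" "Suc i \<le> n"
    using small_reciprocal SVar by blast
  then show ?case
    unfolding close_def by (intro exI[of _ n]) (simp, meson Suc_le_lessD order_trans)
next
  case (SPar a)
  obtain n where "1 / (real n + 1) \<le> e" "0 \<le> n"
    using small_reciprocal SPar by blast
  then show ?case
    by (intro exI[of _ n]) (auto simp: close_def intro: order_trans)
next
  case (SAdd p q)
  then have "sp_params p \<subseteq> cs_ball (CX X) 1" "sp_params q \<subseteq> cs_ball (CX X) 1" "0 < e / 2"
    by simp_all
  then obtain m n where
    mn: "\<forall>f\<in>assignments R. \<forall>g\<in>assignments R. \<forall>x\<in>topspace X. \<forall>y\<in>topspace X.
      close (sp_params p) m f g x y \<longrightarrow> cmod (sp_val (CX X) f p x - sp_val (CX X) g p y) \<le> e / 2"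
    "\<forall>f\<in>assignments R. \<forall>g\<in>assignments R. \<forall>x\<in>topspace X. \<forall>y\<in>topspace X.
      close (sp_params q) n f g x y \<longrightarrow> cmod (sp_val (CX X) f q x - sp_val (CX X) g q y) \<le> e / 2"
    using SAdd.IH[of "e / 2"] by metis
  show ?case
  proof (intro exI[of _ "max m n"] ballI impI)
    fix f g x y assume fg: "f \<in> assignments R" "g \<in> assignments R" and xy: "x \<in> topspace X" "y \<in> topspace X"
      and c: "close (sp_params (SAdd p q)) (max m n) f g x y"
    have "close (sp_params p) m f g x y" "close (sp_params q) n f g x y"
      using close_subset[OF close_mono[OF c, of m]] close_subset[OF close_mono[OF c, of n]] by auto
    then have "cmod (sp_val (CX X) f p x - sp_val (CX X) g p y) \<le> e / 2"
      "cmod (sp_val (CX X) f q x - sp_val (CX X) g q y) \<le> e / 2"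
      using mn fg xy by blast+
    then have "cmod ((sp_val (CX X) f p x - sp_val (CX X) g p y) + (sp_val (CX X) f q x - sp_val (CX X) g q y)) \<le> e / 2 + e / 2"
      by (rule norm_triangle_mono)
    then show "cmod (sp_val (CX X) f (SAdd p q) x - sp_val (CX X) g (SAdd p q) y) \<le> e"
      using xy by (simp add: CX_sels algebra_simps)
  qed
next
  case (SMult p q)
  then have pq: "sp_params p \<subseteq> cs_ball (CX X) 1" "sp_params q \<subseteq> cs_ball (CX X) 1"
    by simp_all
  obtain M where M: "0 \<le> M" "\<forall>f\<in>assignments R. \<forall>x\<in>topspace X. cmod (sp_val (CX X) f p x) \<le> M"
    using sp_val_bounded[OF pq(1), of R] by blast
  obtain N where N: "0 \<le> N" "\<forall>f\<in>assignments R. \<forall>x\<in>topspace X. cmod (sp_val (CX X) f q x) \<le> N"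
    using sp_val_bounded[OF pq(2), of R] by blast
  \<comment> \<open>The error of the product is at most \<open>M * d + d * N\<close>; the summand 1
    keeps the denominator positive.\<close>
  define d where "d = e / (M + N + 1)"
  have d: "0 < d" "(M + N) * d \<le> e"
    using M(1) N(1) SMult.prems(2) by (auto simp: d_def field_simps)
  obtain m n where
    mn: "\<forall>f\<in>assignments R. \<forall>g\<in>assignments R. \<forall>x\<in>topspace X. \<forall>y\<in>topspace X.
      close (sp_params p) m f g x y \<longrightarrow> cmod (sp_val (CX X) f p x - sp_val (CX X) g p y) \<le> d"
    "\<forall>f\<in>assignments R. \<forall>g\<in>assignments R. \<forall>x\<in>topspace X. \<forall>y\<in>topspace X.
      close (sp_params q) n f g x y \<longrightarrow> cmod (sp_val (CX X) f q x - sp_val (CX X) g q y) \<le> d"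
    using SMult.IH[of d] pq d(1) by metis
  show ?case
  proof (intro exI[of _ "max m n"] ballI impI)
    fix f g x y assume fg: "f \<in> assignments R" "g \<in> assignments R" and xy: "x \<in> topspace X" "y \<in> topspace X"
      and c: "close (sp_params (SMult p q)) (max m n) f g x y"
    define a b a' b' where "a = sp_val (CX X) f p x" and "b = sp_val (CX X) f q x"
      and "a' = sp_val (CX X) g p y" and "b' = sp_val (CX X) g q y"
    have "close (sp_params p) m f g x y" "close (sp_params q) n f g x y"
      using close_subset[OF close_mono[OF c, of m]] close_subset[OF close_mono[OF c, of n]] by auto
    then have 1: "cmod (a - a') \<le> d" "cmod (b - b') \<le> d"
      unfolding a_def b_def a'_def b'_def using mn fg xy by blast+
    have 2: "cmod a \<le> M" "cmod b' \<le> N"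
      unfolding a_def b'_def using M N fg xy by blast+
    have "cmod (a * (b - b') + (a - a') * b') \<le> M * d + d * N"
      by (intro norm_triangle_mono) (use 1 2 M(1) d(1) in \<open>auto simp: norm_mult intro: mult_mono\<close>)
    also have "\<dots> \<le> e"
      using d(2) by (simp add: algebra_simps)
    finally have "cmod (a * b - a' * b') \<le> e"
      by (simp add: algebra_simps)
    then show "cmod (sp_val (CX X) f (SMult p q) x - sp_val (CX X) g (SMult p q) y) \<le> e"
      using xy by (simp add: CX_sels a_def b_def a'_def b'_def)
  qed
next
  case (SScale c p)
  define d where "d = e / (cmod c + 1)"
  have "0 < cmod c + 1"
    by (simp add: add_nonneg_pos)
  then have d: "0 < d" "cmod c * d \<le> e"
    using SScale.prems(2) by (auto simp: d_def field_simps)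
  obtain n where n: "\<forall>f\<in>assignments R. \<forall>g\<in>assignments R. \<forall>x\<in>topspace X. \<forall>y\<in>topspace X.
      close (sp_params p) n f g x y \<longrightarrow> cmod (sp_val (CX X) f p x - sp_val (CX X) g p y) \<le> d"
    using SScale.IH[OF _ d(1)] SScale.prems(1) by auto
  show ?case
  proof (intro exI[of _ n] ballI impI)
    fix f g x y assume fg: "f \<in> assignments R" "g \<in> assignments R" and xy: "x \<in> topspace X" "y \<in> topspace X"
      and c: "close (sp_params (SScale c p)) n f g x y"
    then have "cmod (sp_val (CX X) f p x - sp_val (CX X) g p y) \<le> d"
      using n by simp
    then have "cmod (c * (sp_val (CX X) f p x - sp_val (CX X) g p y)) \<le> e"
      using d(2) by (simp add: norm_mult) (meson mult_left_mono norm_ge_zero order_trans)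
    then show "cmod (sp_val (CX X) f (SScale c p) x - sp_val (CX X) g (SScale c p) y) \<le> e"
      using xy by (simp add: CX_sels right_diff_distrib)
  qed
next
  case (SStar p)
  then obtain n where n: "\<forall>f\<in>assignments R. \<forall>g\<in>assignments R. \<forall>x\<in>topspace X. \<forall>y\<in>topspace X.
      close (sp_params p) n f g x y \<longrightarrow> cmod (sp_val (CX X) f p x - sp_val (CX X) g p y) \<le> e"
    by (metis starpoly.set(6))
  have "cmod (cnj a - cnj b) = cmod (a - b)" for a b
    by (metis complex_cnj_diff complex_mod_cnj)
  with n show ?case
    by (intro exI[of _ n]) (simp add: CX_sels)
qed

text \<open>Together with its converse this is closeness, in the Hausdorff sense, of the joint
  images of the first \<open>n\<close> variables and the parameters.\<close>

definition image_sim :: "('a \<Rightarrow> complex) set \<Rightarrow> nat \<Rightarrow> (nat \<Rightarrow> 'a \<Rightarrow> complex) \<Rightarrow> (nat \<Rightarrow> 'a \<Rightarrow> complex) \<Rightarrow> bool" where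
  "image_sim P n f g \<longleftrightarrow> (\<forall>x\<in>topspace X. \<exists>y\<in>topspace X. close P n f g x y)"

lemma image_sim_mono: "image_sim P n f g \<Longrightarrow> m \<le> n \<Longrightarrow> image_sim P m f g"
  unfolding image_sim_def by (meson close_mono)

lemma openin_Collect_Ball:
  assumes "finite P" "\<And>p. p \<in> P \<Longrightarrow> openin X {x \<in> topspace X. Q p x}"
  shows "openin X {x \<in> topspace X. \<forall>p\<in>P. Q p x}"
  using assms
proof (induction P rule: finite_induct)
  case (insert p P)
  have "{x \<in> topspace X. \<forall>q\<in>insert p P. Q q x} = {x \<in> topspace X. Q p x} \<inter> {x \<in> topspace X. \<forall>q\<in>P. Q q x}"
    by auto
  then show ?case
    using insert by (simp add: openin_Int)
qed simp

text \<open>A quantifier costs a factor 3 in precision: \<open>x\<close> is within \<open>d\<close>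
  of the representative \<open>w y\<close> of its type, and \<open>w y\<close> is within
  \<open>2 * d\<close> of \<open>y\<close>.\<close>

lemma image_sim_extend:
  assumes noiso: "isolated_points X = {}"
    and P: "finite P" "P \<subseteq> cs_ball (CX X) 1"
    and fg: "f \<in> assignments R" "g \<in> assignments R"
    and sim: "image_sim P (3 * n + 3) f g" "image_sim P (3 * n + 3) g f"
    and u: "u \<in> cs_ball (CX X) r"
  obtains v where "v \<in> cs_ball (CX X) r"
    "image_sim P n (f(k := u)) (g(k := v))" "image_sim P n (g(k := v)) (f(k := u))"
proof -
  let ?N = "3 * n + 3"
  \<comment> \<open>Here \<open>3 * d = 3 / (3 * n + 4)\<close>, which is below
    \<open>1 / (n + 1)\<close>.\<close>
  define d where "d = 1 / (real ?N + 1)"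
  have d: "0 < d" "3 * d \<le> 1 / (real n + 1)"
    by (auto simp: d_def field_simps)
  define E where "E i x \<longleftrightarrow> (\<forall>j\<in>{..<?N}. dist (f j i) (f j x) < d) \<and> (\<forall>p\<in>P. dist (p i) (p x) < d) \<and> dist (u i) (u x) < d" for i x
  \<comment> \<open>The radius is \<open>2 * d\<close> because \<open>y\<close> is compared with
    \<open>i\<close> through a matched point \<open>x\<close>: one \<open>d\<close> for
    \<open>close\<close>, another for \<open>E i x\<close>.\<close>
  define D where "D i y \<longleftrightarrow> (\<forall>j\<in>{..<?N}. dist (f j i) (g j y) < 2 * d) \<and> (\<forall>p\<in>P. dist (p i) (p y) < 2 * d)" for i y
  have cf: "continuous_map X euclidean (f j)" and cg: "continuous_map X euclidean (g j)" for j
    using fg by (auto simp: assignments_def mem_CX_ball image_subset_iff)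
  have cp: "continuous_map X euclidean p" if "p \<in> P" for p
    using that P(2) by (auto simp: mem_CX_ball)
  have cu: "continuous_map X euclidean u"
    using u by (simp add: mem_CX_ball)
  have E1: "openin X {x \<in> topspace X. E i x}" for i
  proof -
    have "{x \<in> topspace X. E i x} = {x \<in> topspace X. \<forall>j\<in>{..<?N}. dist (f j i) (f j x) < d} \<inter>
        ({x \<in> topspace X. \<forall>p\<in>P. dist (p i) (p x) < d} \<inter> {x \<in> topspace X. dist (u i) (u x) < d})"
      unfolding E_def by blast
    then show ?thesis
      by (simp only:) (intro openin_Int openin_Collect_Ball openin_ball_preimage cf cp cu P(1) finite_lessThan)
  qed
  have D1: "openin X {x \<in> topspace X. D i x}" for i
  proof -
    have "{x \<in> topspace X. D i x} = {x \<in> topspace X. \<forall>j\<in>{..<?N}. dist (f j i) (g j x) < 2 * d} \<inter>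
        {x \<in> topspace X. \<forall>p\<in>P. dist (p i) (p x) < 2 * d}"
      unfolding D_def by blast
    then show ?thesis
      by (simp only:) (intro openin_Int openin_Collect_Ball openin_ball_preimage cg cp P(1) finite_lessThan)
  qed
  have E2: "E i i" for i
    using d by (simp add: E_def)
  have lt: "a < 2 * d" if "a \<le> d" for a
    using that d(1) by simp
  have D2: "\<exists>y\<in>topspace X. D i y" if i: "i \<in> topspace X" for i
  proof -
    obtain y where y: "y \<in> topspace X" "close P ?N f g i y"
      using sim(1) i unfolding image_sim_def by blast
    then have "D i y"
      unfolding D_def close_def d_def[symmetric] dist_norm using lt by simp
    with y(1) show ?thesis
      by blast
  qed
  have D3: "\<exists>x\<in>topspace X. \<forall>i\<in>topspace X. E i x \<longrightarrow> D i y" if y: "y \<in> topspace X" for y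
  proof -
    obtain x where x: "x \<in> topspace X" "close P ?N g f y x"
      using sim(2) y unfolding image_sim_def by blast
    have "D i y" if "E i x" for i
    proof -
      have "dist (f j i) (g j y) < 2 * d" if j: "j < ?N" for j
      proof -
        have "dist (f j x) (g j y) \<le> d"
          using x(2) j unfolding close_def d_def[symmetric] by (simp add: dist_norm norm_minus_commute)
        moreover have "dist (f j i) (f j x) < d"
          using \<open>E i x\<close> j by (simp add: E_def)
        ultimately show ?thesis
          using dist_triangle[of "f j i" "g j y" "f j x"] by linarith
      qed
      moreover have "dist (p i) (p y) < 2 * d" if p: "p \<in> P" for p
      proof -
        have "dist (p x) (p y) \<le> d"
          using x(2) p unfolding close_def d_def[symmetric] by (simp add: dist_norm norm_minus_commute)
        moreover have "dist (p i) (p x) < d"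
          using \<open>E i x\<close> p by (simp add: E_def)
        ultimately show ?thesis
          using dist_triangle[of "p i" "p y" "p x"] by linarith
      qed
      ultimately show ?thesis
        by (simp add: D_def)
    qed
    with x(1) show ?thesis
      by blast
  qed
  have D4: "i = p" if "i \<in> topspace X" "p \<in> isolated_points X" "D i p" for i p
    using that noiso by simp
  show thesis
  proof (rule transport[of E D, OF E1 E2 D1 D2 D3 D4])
    fix w assume w: "\<And>i. clopenin X {x \<in> topspace X. w x = i}" "finite (w ` topspace X)"
      "\<And>y. y \<in> topspace X \<Longrightarrow> w y \<in> topspace X \<and> D (w y) y"
      "\<And>x. x \<in> topspace X \<Longrightarrow> \<exists>y\<in>topspace X. E (w y) x"
    define v where "v = (\<lambda>y\<in>topspace X. u (w y))"
    have "continuous_map X euclidean (\<lambda>y. u (w y))"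
      using w(1) by (intro continuous_map_locally_constant) (simp add: clopenin_def)
    then have "continuous_map X euclidean v"
      unfolding v_def by (auto elim: continuous_map_eq)
    then have v: "v \<in> cs_ball (CX X) r"
      using u w(3) by (auto simp: mem_CX_ball v_def)
    have step: "close P n (f(k := u)) (g(k := v)) x y" if y: "y \<in> topspace X" and x: "E (w y) x" for x y
    proof -
      have Dy: "D (w y) y"
        using w(3) y by blast
      have "dist (f j x) (g j y) \<le> 3 * d" if "j < n" for j
      proof -
        have "dist (f j (w y)) (g j y) < 2 * d" "dist (f j (w y)) (f j x) < d"
          using Dy x that by (simp_all add: D_def E_def)
        then show ?thesis
          using dist_triangle3[of "f j x" "g j y" "f j (w y)"] by linarith
      qed
      moreover have "dist (p x) (p y) \<le> 3 * d" if "p \<in> P" for p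
      proof -
        have "dist (p (w y)) (p y) < 2 * d" "dist (p (w y)) (p x) < d"
          using Dy x that by (simp_all add: D_def E_def)
        then show ?thesis
          using dist_triangle3[of "p x" "p y" "p (w y)"] by linarith
      qed
      moreover have "dist (u x) (v y) \<le> 3 * d"
        using x y d(1) by (simp add: E_def v_def dist_commute)
      ultimately show ?thesis
        using d(2) unfolding close_def dist_norm by (fastforce intro: order_trans)
    qed
    have "image_sim P n (f(k := u)) (g(k := v))"
      unfolding image_sim_def using step w(4) by meson
    \<comment> \<open>In this direction \<open>y\<close> is matched with \<open>w y\<close>, which
      satisfies its own type.\<close>
    moreover have "image_sim P n (g(k := v)) (f(k := u))"
    proof -
      have sym: "close P n (g(k := v)) (f(k := u)) y x" if "close P n (f(k := u)) (g(k := v)) x y" for x y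
        using that by (auto simp: close_def norm_minus_commute)
      show ?thesis
        unfolding image_sim_def using step sym w(3) E2 by meson
    qed
    ultimately show thesis
      using v by (intro that)
  qed
qed

lemma CConn_arg_cube:
  assumes "\<And>\<psi>. \<psi> \<in> set \<phi>s \<Longrightarrow> \<bar>cf_val C f \<psi>\<bar> \<le> M"
  shows "(\<lambda>j. if j < length \<phi>s then map (cf_val C f) \<phi>s ! j else 0) \<in> cube (length \<phi>s) M"
  using assms by (auto simp: cube_def)

lemma cs_ball_nonempty: "0 \<le> r \<Longrightarrow> cs_ball (CX X) r \<noteq> {}"
  using CX_zero_ball by blast

text \<open>Boundedness makes the suprema and infima of reals meaningful and confines the arguments
  of a connective to a compact box. The induction is over all \<open>R\<close>, since quantifiers
  enlarge the radius.\<close>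

lemma cf_val_bounded:
  assumes P: "P \<subseteq> cs_ball (CX X) 1"
  shows "cf_wf \<phi> \<Longrightarrow> cf_params \<phi> \<subseteq> P \<Longrightarrow> \<exists>M. \<forall>f\<in>assignments R. \<bar>cf_val (CX X) f \<phi>\<bar> \<le> M"
proof (induction \<phi> arbitrary: R)
  case (CNorm p)
  then have "sp_params p \<subseteq> cs_ball (CX X) 1"
    using P by simp
  then obtain M where M: "0 \<le> M" "\<And>f x. f \<in> assignments R \<Longrightarrow> x \<in> topspace X \<Longrightarrow> cmod (sp_val (CX X) f p x) \<le> M"
    using sp_val_bounded by metis
  have "\<bar>cf_val (CX X) f (CNorm p)\<bar> \<le> M" if f: "f \<in> assignments R" for f
  proof -
    have "0 \<le> cs_norm (CX X) (sp_val (CX X) f p)"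
      using M(2)[OF f] by (intro CX_norm_nonneg bdd_aboveI2)
    moreover have "cs_norm (CX X) (sp_val (CX X) f p) \<le> M"
      using M f by (intro CX_norm_le)
    ultimately show ?thesis
      by simp
  qed
  then show ?case
    by blast
next
  case (CConn u \<phi>s)
  have "\<forall>\<psi>\<in>set \<phi>s. \<exists>M. \<forall>f\<in>assignments R. \<bar>cf_val (CX X) f \<psi>\<bar> \<le> M"
    using CConn by (auto simp: UN_subset_iff)
  then obtain M where M: "\<And>\<psi> f. \<psi> \<in> set \<phi>s \<Longrightarrow> f \<in> assignments R \<Longrightarrow> \<bar>cf_val (CX X) f \<psi>\<bar> \<le> M \<psi>"
    by metis
  define N where "N = Max (insert 0 (M ` set \<phi>s))"
  have "\<bar>cf_val (CX X) f \<psi>\<bar> \<le> N" if "\<psi> \<in> set \<phi>s" "f \<in> assignments R" for \<psi> f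
    using M[OF that] that(1) unfolding N_def by (intro order_trans[OF _ Max_ge[of _ "M \<psi>"]]) auto
  then have "(\<lambda>j. if j < length \<phi>s then map (cf_val (CX X) f) \<phi>s ! j else 0) \<in> cube (length \<phi>s) N"
    if "f \<in> assignments R" for f
    using that by (intro CConn_arg_cube)
  moreover have "continuous_map (Euclidean_space (length \<phi>s)) euclideanreal u"
    using CConn.prems by simp
  then obtain B where "\<And>a. a \<in> cube (length \<phi>s) N \<Longrightarrow> \<bar>u a\<bar> \<le> B"
    using cube_bounded by metis
  ultimately show ?case
    by (intro exI[of _ B]) simp
next
  case (CSup n k \<phi>)
  then obtain M where M: "\<And>f. f \<in> assignments (max R n) \<Longrightarrow> \<bar>cf_val (CX X) f \<phi>\<bar> \<le> M"
    by (metis cform.set(3) cf_wf.simps(3))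
  then show ?case
    using cs_ball_nonempty[of "real n"] assignments_update
    by (intro exI[of _ M]) (auto intro!: cSup_abs_le M)
next
  case (CInf n k \<phi>)
  then obtain M where M: "\<And>f. f \<in> assignments (max R n) \<Longrightarrow> \<bar>cf_val (CX X) f \<phi>\<bar> \<le> M"
    by (metis cform.set(4) cf_wf.simps(4))
  then show ?case
    using cs_ball_nonempty[of "real n"] assignments_update
    by (intro exI[of _ M]) (auto intro!: cInf_abs_ge M)
qed

text \<open>A semantic form of quantifier elimination: the value of a formula depends, uniformly
  continuously, only on the joint image of the variables and parameters.\<close>

lemma cf_val_close:
  assumes noiso: "isolated_points X = {}"
    and P: "finite P" "P \<subseteq> cs_ball (CX X) 1"
  shows "cf_wf \<phi> \<Longrightarrow> cf_params \<phi> \<subseteq> P \<Longrightarrow> 0 < e \<Longrightarrow>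
    \<exists>n. \<forall>f\<in>assignments R. \<forall>g\<in>assignments R. image_sim P n f g \<and> image_sim P n g f \<longrightarrow>
      \<bar>cf_val (CX X) f \<phi> - cf_val (CX X) g \<phi>\<bar> \<le> e"
proof (induction \<phi> arbitrary: R e)
  case (CNorm p)
  then have p: "sp_params p \<subseteq> cs_ball (CX X) 1"
    using P by auto
  obtain n where n: "\<And>f g x y. f \<in> assignments R \<Longrightarrow> g \<in> assignments R \<Longrightarrow> x \<in> topspace X \<Longrightarrow> y \<in> topspace X \<Longrightarrow>
      close (sp_params p) n f g x y \<Longrightarrow> cmod (sp_val (CX X) f p x - sp_val (CX X) g p y) \<le> e"
    using sp_val_close[OF p CNorm.prems(3)] by metis
  obtain M where M: "\<And>f x. f \<in> assignments R \<Longrightarrow> x \<in> topspace X \<Longrightarrow> cmod (sp_val (CX X) f p x) \<le> M"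
    using sp_val_bounded[OF p] by metis
  have half: "cs_norm (CX X) (sp_val (CX X) f p) \<le> cs_norm (CX X) (sp_val (CX X) g p) + e"
    if fg: "f \<in> assignments R" "g \<in> assignments R" and sim: "image_sim P n f g" for f g
  proof (rule CX_norm_le)
    have bdd: "bdd_above ((\<lambda>x. cmod (sp_val (CX X) g p x)) ` topspace X)"
      using M[OF fg(2)] by (intro bdd_aboveI2)
    show "0 \<le> cs_norm (CX X) (sp_val (CX X) g p) + e"
      using CX_norm_nonneg[OF bdd] CNorm.prems(3) by simp
    fix x assume x: "x \<in> topspace X"
    then obtain y where y: "y \<in> topspace X" "close P n f g x y"
      using sim unfolding image_sim_def by blast
    have "close (sp_params p) n f g x y"
      using y(2) CNorm.prems(2) by (auto intro: close_subset)
    then have "cmod (sp_val (CX X) f p x - sp_val (CX X) g p y) \<le> e"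
      using n fg x y(1) by blast
    moreover have "cmod (sp_val (CX X) g p y) \<le> cs_norm (CX X) (sp_val (CX X) g p)"
      by (rule CX_norm_ge[OF bdd y(1)])
    ultimately show "cmod (sp_val (CX X) f p x) \<le> cs_norm (CX X) (sp_val (CX X) g p) + e"
      using norm_triangle_sub[of "sp_val (CX X) f p x" "sp_val (CX X) g p y"] by linarith
  qed
  show ?case
  proof (intro exI[of _ n] ballI impI)
    fix f g assume "f \<in> assignments R" "g \<in> assignments R" "image_sim P n f g \<and> image_sim P n g f"
    then show "\<bar>cf_val (CX X) f (CNorm p) - cf_val (CX X) g (CNorm p)\<bar> \<le> e"
      using half[of f g] half[of g f] by (simp add: abs_le_iff)
  qed
next
  case (CConn u \<phi>s)
  have wf: "cf_wf \<psi>" "cf_params \<psi> \<subseteq> P" if "\<psi> \<in> set \<phi>s" for \<psi>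
    using CConn.prems that by auto
  have "\<forall>\<psi>\<in>set \<phi>s. \<exists>M. \<forall>f\<in>assignments R. \<bar>cf_val (CX X) f \<psi>\<bar> \<le> M"
    using cf_val_bounded[OF P(2)] wf by blast
  then obtain M where M: "\<And>\<psi> f. \<psi> \<in> set \<phi>s \<Longrightarrow> f \<in> assignments R \<Longrightarrow> \<bar>cf_val (CX X) f \<psi>\<bar> \<le> M \<psi>"
    by metis
  define N where "N = Max (insert 0 (M ` set \<phi>s))"
  have "\<bar>cf_val (CX X) f \<psi>\<bar> \<le> N" if "\<psi> \<in> set \<phi>s" "f \<in> assignments R" for \<psi> f
    using M[OF that] that(1) unfolding N_def by (intro order_trans[OF _ Max_ge[of _ "M \<psi>"]]) auto
  then have cube: "(\<lambda>j. if j < length \<phi>s then map (cf_val (CX X) f) \<phi>s ! j else 0) \<in> cube (length \<phi>s) N"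
    if "f \<in> assignments R" for f
    using that by (intro CConn_arg_cube)
  have "continuous_map (Euclidean_space (length \<phi>s)) euclideanreal u"
    using CConn.prems by simp
  then obtain d where d: "0 < d"
    "\<And>a b. a \<in> cube (length \<phi>s) N \<Longrightarrow> b \<in> cube (length \<phi>s) N \<Longrightarrow> (\<And>i. i < length \<phi>s \<Longrightarrow> \<bar>a i - b i\<bar> \<le> d) \<Longrightarrow> \<bar>u a - u b\<bar> \<le> e"
    using cube_uniformly_continuous[OF _ CConn.prems(3)] by metis
  have "\<forall>\<psi>\<in>set \<phi>s. \<exists>n. \<forall>f\<in>assignments R. \<forall>g\<in>assignments R. image_sim P n f g \<and> image_sim P n g f \<longrightarrow>
      \<bar>cf_val (CX X) f \<psi> - cf_val (CX X) g \<psi>\<bar> \<le> d"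
    using CConn.IH wf d(1) by blast
  then obtain n where n: "\<And>\<psi> f g. \<psi> \<in> set \<phi>s \<Longrightarrow> f \<in> assignments R \<Longrightarrow> g \<in> assignments R \<Longrightarrow>
      image_sim P (n \<psi>) f g \<Longrightarrow> image_sim P (n \<psi>) g f \<Longrightarrow> \<bar>cf_val (CX X) f \<psi> - cf_val (CX X) g \<psi>\<bar> \<le> d"
    by metis
  define m where "m = Max (insert 0 (n ` set \<phi>s))"
  have m: "n \<psi> \<le> m" if "\<psi> \<in> set \<phi>s" for \<psi>
    unfolding m_def using that by (intro Max_ge) auto
  show ?case
  proof (intro exI[of _ m] ballI impI)
    fix f g assume fg: "f \<in> assignments R" "g \<in> assignments R" and sim: "image_sim P m f g \<and> image_sim P m g f"
    have "\<bar>cf_val (CX X) f \<psi> - cf_val (CX X) g \<psi>\<bar> \<le> d" if \<psi>: "\<psi> \<in> set \<phi>s" for \<psi>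
      using n[OF \<psi> fg] sim image_sim_mono m[OF \<psi>] by blast
    then show "\<bar>cf_val (CX X) f (CConn u \<phi>s) - cf_val (CX X) g (CConn u \<phi>s)\<bar> \<le> e"
      unfolding cf_val.simps by (intro d(2) cube fg) simp
  qed
next
  case (CSup m k \<phi>)
  then have \<phi>: "cf_wf \<phi>" "cf_params \<phi> \<subseteq> P"
    by simp_all
  let ?R = "max R (real m)" and ?B = "cs_ball (CX X) (real m)"
  obtain n where n: "\<And>f g. f \<in> assignments ?R \<Longrightarrow> g \<in> assignments ?R \<Longrightarrow>
      image_sim P n f g \<Longrightarrow> image_sim P n g f \<Longrightarrow> \<bar>cf_val (CX X) f \<phi> - cf_val (CX X) g \<phi>\<bar> \<le> e"
    using CSup.IH[OF \<phi> CSup.prems(3), of ?R] by metis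
  obtain M where M: "\<And>f. f \<in> assignments ?R \<Longrightarrow> \<bar>cf_val (CX X) f \<phi>\<bar> \<le> M"
    using cf_val_bounded[OF P(2) \<phi>] by metis
  \<comment> \<open>Each \<open>y\<close> in the ball is matched with some \<open>z\<close>; this
    takes level \<open>3 * n + 3\<close> when the body takes level \<open>n\<close>.\<close>
  have half: "cf_val (CX X) f (CSup m k \<phi>) \<le> cf_val (CX X) g (CSup m k \<phi>) + e"
    if fg: "f \<in> assignments R" "g \<in> assignments R"
      and sim: "image_sim P (3 * n + 3) f g" "image_sim P (3 * n + 3) g f" for f g
    unfolding cf_val.simps
  proof (rule cSUP_le_add[OF cs_ball_nonempty])
    show "bdd_above ((\<lambda>y. cf_val (CX X) (g(k := y)) \<phi>) ` ?B)"
      using M assignments_update[OF fg(2)] by (intro bdd_aboveI2[of _ _ M]) (auto simp: abs_le_iff)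
    fix y assume y: "y \<in> ?B"
    show "\<exists>z\<in>?B. \<bar>cf_val (CX X) (f(k := y)) \<phi> - cf_val (CX X) (g(k := z)) \<phi>\<bar> \<le> e"
    proof (rule image_sim_extend[OF noiso P fg sim y])
      fix v assume v: "v \<in> ?B" "image_sim P n (f(k := y)) (g(k := v))" "image_sim P n (g(k := v)) (f(k := y))"
      then show ?thesis
        using n[OF assignments_update[OF fg(1) y] assignments_update[OF fg(2) v(1)]] by blast
    qed
  qed simp
  show ?case
  proof (intro exI[of _ "3 * n + 3"] ballI impI)
    fix f g assume "f \<in> assignments R" "g \<in> assignments R"
      "image_sim P (3 * n + 3) f g \<and> image_sim P (3 * n + 3) g f"
    then show "\<bar>cf_val (CX X) f (CSup m k \<phi>) - cf_val (CX X) g (CSup m k \<phi>)\<bar> \<le> e"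
      using half[of f g] half[of g f] unfolding abs_le_iff by linarith
  qed
next
  case (CInf m k \<phi>)
  then have \<phi>: "cf_wf \<phi>" "cf_params \<phi> \<subseteq> P"
    by simp_all
  let ?R = "max R (real m)" and ?B = "cs_ball (CX X) (real m)"
  obtain n where n: "\<And>f g. f \<in> assignments ?R \<Longrightarrow> g \<in> assignments ?R \<Longrightarrow>
      image_sim P n f g \<Longrightarrow> image_sim P n g f \<Longrightarrow> \<bar>cf_val (CX X) f \<phi> - cf_val (CX X) g \<phi>\<bar> \<le> e"
    using CInf.IH[OF \<phi> CInf.prems(3), of ?R] by metis
  obtain M where M: "\<And>f. f \<in> assignments ?R \<Longrightarrow> \<bar>cf_val (CX X) f \<phi>\<bar> \<le> M"
    using cf_val_bounded[OF P(2) \<phi>] by metis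
  have half: "cf_val (CX X) g (CInf m k \<phi>) - e \<le> cf_val (CX X) f (CInf m k \<phi>)"
    if fg: "f \<in> assignments R" "g \<in> assignments R"
      and sim: "image_sim P (3 * n + 3) f g" "image_sim P (3 * n + 3) g f" for f g
    unfolding cf_val.simps
  proof (rule cINF_le_add[OF cs_ball_nonempty])
    show "bdd_below ((\<lambda>y. cf_val (CX X) (g(k := y)) \<phi>) ` ?B)"
    proof (rule bdd_belowI2[of _ "- M"])
      fix y assume "y \<in> ?B"
      then show "- M \<le> cf_val (CX X) (g(k := y)) \<phi>"
        using M[OF assignments_update[OF fg(2)], of y k] by (simp add: abs_le_iff)
    qed
    fix y assume y: "y \<in> ?B"
    show "\<exists>z\<in>?B. \<bar>cf_val (CX X) (f(k := y)) \<phi> - cf_val (CX X) (g(k := z)) \<phi>\<bar> \<le> e"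
    proof (rule image_sim_extend[OF noiso P fg sim y])
      fix v assume v: "v \<in> ?B" "image_sim P n (f(k := y)) (g(k := v))" "image_sim P n (g(k := v)) (f(k := y))"
      then show ?thesis
        using n[OF assignments_update[OF fg(1) y] assignments_update[OF fg(2) v(1)]] by blast
    qed
  qed simp
  show ?case
  proof (intro exI[of _ "3 * n + 3"] ballI impI)
    fix f g assume "f \<in> assignments R" "g \<in> assignments R"
      "image_sim P (3 * n + 3) f g \<and> image_sim P (3 * n + 3) g f"
    then show "\<bar>cf_val (CX X) f (CInf m k \<phi>) - cf_val (CX X) g (CInf m k \<phi>)\<bar> \<le> e"
      using half[of f g] half[of g f] unfolding abs_le_iff by linarith
  qed
qed

end

subsection \<open>Coding functions by clopen sets\<close>

text \<open>Since the ratio exceeds \<open>1/2\<close>, every number in \<open>[-1, 1]\<close> is a signed sum of the terms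
  \<open>(2/3)^l / 3\<close> with room to choose the signs as locally constant functions.\<close>

definition signed_sum :: "(nat \<Rightarrow> bool) \<Rightarrow> real" where
  "signed_sum e = (\<Sum>l. (if e l then 1 else - 1) * ((2 / 3) ^ l / 3))"

lemma signed_sum_summable: "summable (\<lambda>l. (if e l then 1 else - 1) * ((2 / 3) ^ l / 3) :: real)"
proof (rule summable_comparison_test')
  show "summable (\<lambda>l. (2 / 3 :: real) ^ l)"
    by (simp add: summable_geometric)
  show "norm ((if e n then 1 else - 1) * ((2 / 3) ^ n / 3) :: real) \<le> (2 / 3) ^ n" if "0 \<le> n" for n
    by simp
qed

text \<open>Signs differ by at most 2, and the weights from \<open>L\<close> on add up to
  \<open>(2 / 3) ^ L\<close>.\<close>

lemma signed_sum_agree: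
  assumes "\<And>l. l < L \<Longrightarrow> e l = e' l"
  shows "\<bar>signed_sum e - signed_sum e'\<bar> \<le> 2 * (2 / 3) ^ L"
proof -
  define c where "c l = (if e l then 1 else - 1) * ((2 / 3) ^ l / 3 :: real) -
      (if e' l then 1 else - 1) * ((2 / 3) ^ l / 3 :: real)" for l :: nat
  have sc: "summable c"
    unfolding c_def by (intro summable_diff signed_sum_summable)
  have "signed_sum e - signed_sum e' = suminf c"
    unfolding signed_sum_def c_def by (intro suminf_diff signed_sum_summable)
  also have "\<dots> = (\<Sum>l. c (l + L))"
    using suminf_split_initial_segment[OF sc, of L] assms by (simp add: c_def)
  finally have eq: "signed_sum e - signed_sum e' = (\<Sum>l. c (l + L))" .
  have le: "norm (c (l + L)) \<le> (2 / 3) ^ L * (2 / 3 * (2 / 3) ^ l)" for l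
    by (simp add: c_def power_add)
  have g: "(\<lambda>l. (2 / 3 :: real) ^ l) sums 3"
    using geometric_sums[of "2 / 3 :: real"] by simp
  then have "(\<lambda>l. (2 / 3) ^ L * (2 / 3 * (2 / 3 :: real) ^ l)) sums ((2 / 3) ^ L * (2 / 3 * 3))"
    by (intro sums_mult)
  then have s: "summable (\<lambda>l. (2 / 3) ^ L * (2 / 3 * (2 / 3 :: real) ^ l))"
    and v: "(\<Sum>l. (2 / 3) ^ L * (2 / 3 * (2 / 3 :: real) ^ l)) = 2 * (2 / 3) ^ L"
    by (simp_all add: sums_iff)
  have "norm (\<Sum>l. c (l + L)) \<le> (\<Sum>l. (2 / 3) ^ L * (2 / 3 * (2 / 3 :: real) ^ l))"
    using le s by (rule norm_suminf_le)
  then show ?thesis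
    using eq v by simp
qed

text \<open>The Boolean index separates real digits (\<open>True\<close>) from imaginary ones
  (\<open>False\<close>). Every bit sequence has a value, whether or not it codes a number of the
  unit disc.\<close>

definition decode :: "(nat \<Rightarrow> bool \<Rightarrow> bool) \<Rightarrow> complex" where
  "decode e = Complex (signed_sum (\<lambda>l. e l True)) (signed_sum (\<lambda>l. e l False))"

lemma decode_agree:
  assumes "\<And>l c. l < L \<Longrightarrow> e l c = e' l c"
  shows "cmod (decode e - decode e') \<le> 4 * (2 / 3) ^ L"
proof -
  have "cmod (decode e - decode e') \<le> \<bar>Re (decode e - decode e')\<bar> + \<bar>Im (decode e - decode e')\<bar>"
    by (rule cmod_le)
  also have "\<dots> \<le> 2 * (2 / 3) ^ L + 2 * (2 / 3) ^ L"
    unfolding decode_def minus_complex.sel complex.sel using assms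
    by (intro add_mono signed_sum_agree) auto
  finally show ?thesis
    by simp
qed

lemma decode_uniform:
  assumes "0 < r" obtains L where "\<And>e e'. (\<And>l c. l < L \<Longrightarrow> e l c = e' l c) \<Longrightarrow> cmod (decode e - decode e') \<le> r"
proof -
  obtain L where "(2 / 3 :: real) ^ L < r / 4"
    using real_arch_pow_inv[of "r / 4" "2 / 3"] assms by auto
  then have "4 * (2 / 3 :: real) ^ L \<le> r"
    by simp
  then show thesis
    using that[of L] decode_agree order_trans by blast
qed

context boolean_space
begin

text \<open>Greedy expansion: before digit \<open>n\<close> the remainder is at most
  \<open>3 * q\<close> in modulus, with \<open>q = (2 / 3) ^ n / 3\<close>. The sign is prescribed
  only outside the interval from \<open>-q\<close> to \<open>q\<close>; inside it either sign leaves
  at most \<open>2 * q\<close>, so a clopen set can choose.\<close>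

lemma real_encode:
  assumes h: "continuous_map X euclideanreal h" "\<And>x. x \<in> topspace X \<Longrightarrow> \<bar>h x\<bar> \<le> 1"
  obtains U where "\<And>l. clopenin X (U l)" "\<And>x. x \<in> topspace X \<Longrightarrow> h x = signed_sum (\<lambda>l. x \<in> U l)"
proof -
  define sep where "sep n r U \<longleftrightarrow> clopenin X U \<and> {x \<in> topspace X. (2 / 3) ^ n / 3 \<le> r x} \<subseteq> U \<and>
      U \<inter> {x \<in> topspace X. r x \<le> - ((2 / 3) ^ n / 3)} = {}" for n and r :: "'a \<Rightarrow> real" and U
  have sep_ex: "\<exists>U. sep n r U" if r: "continuous_map X euclideanreal r" for n r
  proof -
    have cl: "closedin X {x \<in> topspace X. c \<le> r x}" "closedin X {x \<in> topspace X. r x \<le> c}" for c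
      using closedin_continuous_map_preimage[OF r, of "{c..}"]
        closedin_continuous_map_preimage[OF r, of "{..c}"] by simp_all
    have disj: "{x \<in> topspace X. (2 / 3) ^ n / 3 \<le> r x} \<inter> {x \<in> topspace X. r x \<le> - ((2 / 3) ^ n / 3)} = {}"
    proof -
      have "0 < (2 / 3 :: real) ^ n / 3"
        by simp
      then have False if "(2 / 3) ^ n / 3 \<le> r x" "r x \<le> - ((2 / 3) ^ n / 3)" for x
        using that by linarith
      then show ?thesis
        by blast
    qed
    obtain U where "clopenin X U" "{x \<in> topspace X. (2 / 3) ^ n / 3 \<le> r x} \<subseteq> U"
        "U \<inter> {x \<in> topspace X. r x \<le> - ((2 / 3) ^ n / 3)} = {}"
      by (rule clopen_separation[OF cl disj])
    then show ?thesis
      by (auto simp: sep_def)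
  qed
  \<comment> \<open>The set depends on the remainder, which depends on the earlier sets. Choosing it
    as a function of \<open>n\<close> and the remainder makes the recursion for \<open>r\<close>
    possible.\<close>
  define V where "V n r = (SOME U. sep n r U)" for n r
  have V: "clopenin X (V n r) \<and> {x \<in> topspace X. (2 / 3) ^ n / 3 \<le> r x} \<subseteq> V n r \<and>
      V n r \<inter> {x \<in> topspace X. r x \<le> - ((2 / 3) ^ n / 3)} = {}" if "continuous_map X euclideanreal r" for n r
    using someI_ex[OF sep_ex[OF that]] unfolding V_def sep_def .
  define r where "r = rec_nat h (\<lambda>n q x. q x - (if x \<in> V n q then 1 else - 1) * ((2 / 3) ^ n / 3))"
  have r0: "r 0 = h" and rS: "r (Suc n) = (\<lambda>x. r n x - (if x \<in> V n (r n) then 1 else - 1) * ((2 / 3) ^ n / 3))" for n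
    by (simp_all add: r_def)
  have cont: "continuous_map X euclideanreal (r n)" for n
  proof (induction n)
    case (Suc n)
    have "clopenin X {x \<in> topspace X. (x \<in> V n (r n)) = c}" for c
      using V[OF Suc] by (intro clopenin_Collect_iff) blast
    then have "continuous_map X euclideanreal (\<lambda>x. (\<lambda>c. (if c then 1 else - 1) * ((2 / 3) ^ n / 3)) (x \<in> V n (r n)))"
      by (intro continuous_map_locally_constant) (simp add: clopenin_def)
    then show ?case
      unfolding rS using Suc by (intro continuous_map_diff) simp_all
  qed (simp add: r0 h)
  have bnd: "\<bar>r n x\<bar> \<le> (2 / 3) ^ n" if x: "x \<in> topspace X" for n x
  proof (induction n)
    case (Suc n)
    define q where "q = (2 / 3 :: real) ^ n / 3"
    have "x \<in> V n (r n) \<Longrightarrow> - q < r n x" "x \<notin> V n (r n) \<Longrightarrow> r n x < q"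
      using V[OF cont[of n], of n] x unfolding q_def by force+
    moreover have "\<bar>r n x\<bar> \<le> 3 * q" "(2 / 3) ^ Suc n = 2 * q"
      using Suc by (simp_all add: q_def)
    moreover have "r (Suc n) x = r n x - (if x \<in> V n (r n) then 1 else - 1) * q"
      by (simp add: rS q_def)
    ultimately show ?case
      by (cases "x \<in> V n (r n)") (simp_all add: abs_le_iff)
  qed (simp add: r0 h(2) x)
  have partial: "h x = (\<Sum>l<n. (if x \<in> V l (r l) then 1 else - 1) * ((2 / 3) ^ l / 3)) + r n x" for n x
    by (induction n) (simp_all add: r0 rS)
  show thesis
  proof (rule that[of "\<lambda>l. V l (r l)"])
    show "clopenin X (V l (r l))" for l
      using V cont by blast
    fix x assume x: "x \<in> topspace X"
    have "(\<lambda>n. (2 / 3 :: real) ^ n) \<longlonglongrightarrow> 0"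
      by (simp add: LIMSEQ_power_zero)
    then have "(\<lambda>n. r n x) \<longlonglongrightarrow> 0"
      by (rule Lim_null_comparison[rotated]) (simp add: bnd[OF x])
    then have "(\<lambda>n. h x - r n x) \<longlonglongrightarrow> h x - 0"
      by (intro tendsto_diff tendsto_const)
    moreover have "h x - r n x = (\<Sum>l<n. (if x \<in> V l (r l) then 1 else - 1) * ((2 / 3) ^ l / 3))" for n
      using partial[of x n] by simp
    ultimately have "(\<lambda>l. (if x \<in> V l (r l) then 1 else - 1) * ((2 / 3) ^ l / 3)) sums h x"
      by (simp add: sums_def)
    then show "h x = signed_sum (\<lambda>l. x \<in> V l (r l))"
      unfolding signed_sum_def by (simp add: sums_iff)
  qed
qed

lemma complex_encode:
  assumes "h \<in> cs_ball (CX X) 1"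
  shows "\<exists>U. (\<forall>l c. clopenin X (U l c)) \<and> (\<forall>x\<in>topspace X. h x = decode (\<lambda>l c. x \<in> U l c))"
proof -
  have h: "continuous_map X euclidean h" "\<And>x. x \<in> topspace X \<Longrightarrow> cmod (h x) \<le> 1"
    using assms by (simp_all add: mem_CX_ball)
  have "continuous_map X euclideanreal (\<lambda>x. Re (h x))" "continuous_map X euclideanreal (\<lambda>x. Im (h x))"
    using continuous_map_compose[OF h(1), of euclideanreal Re] continuous_map_compose[OF h(1), of euclideanreal Im]
    by (simp_all add: o_def continuous_on_Re continuous_on_Im)
  moreover have "\<bar>Re (h x)\<bar> \<le> 1" "\<bar>Im (h x)\<bar> \<le> 1" if "x \<in> topspace X" for x
    using h(2)[OF that] abs_Re_le_cmod[of "h x"] abs_Im_le_cmod[of "h x"] by linarith+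
  ultimately obtain U V where
    "\<And>l. clopenin X (U l)" "\<And>x. x \<in> topspace X \<Longrightarrow> Re (h x) = signed_sum (\<lambda>l. x \<in> U l)"
    "\<And>l. clopenin X (V l)" "\<And>x. x \<in> topspace X \<Longrightarrow> Im (h x) = signed_sum (\<lambda>l. x \<in> V l)"
    by (metis real_encode)
  then show ?thesis
    by (intro exI[of _ "\<lambda>l c. if c then U l else V l"]) (simp add: decode_def complex_eq_iff)
qed

text \<open>The limit is taken among the digit sets of the approximate solutions \<open>c m\<close>
  and then decoded. Agreement in finitely many digits makes joint images close, and formulas are
  continuous in these.\<close>

theorem CX_saturated:
  assumes sat: "countably_degree1_saturated (CX X)" and noiso: "isolated_points X = {}"
  shows "countably_saturated (CX X)"
  unfolding countably_saturated_def countably_saturated_for_def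
proof (intro allI impI, elim conjE)
  fix \<phi> :: "nat \<Rightarrow> ('a \<Rightarrow> complex) cform" and K :: "nat \<Rightarrow> real set"
  assume \<phi>: "\<forall>n. \<phi> n \<in> {\<phi>. cf_wf \<phi>} \<and> cf_params (\<phi> n) \<subseteq> cs_ball (CX X) 1"
    and K: "\<forall>n. compact (K n)"
    and approx: "\<forall>\<epsilon>>0. \<forall>F. finite F \<longrightarrow>
        (\<exists>b. range b \<subseteq> cs_ball (CX X) 1 \<and> (\<forall>n\<in>F. \<exists>r\<in>K n. \<bar>cf_val (CX X) b (\<phi> n) - r\<bar> \<le> \<epsilon>))"
  have "\<exists>b. range b \<subseteq> cs_ball (CX X) 1 \<and> (\<forall>n\<in>{..m}. \<exists>r\<in>K n. \<bar>cf_val (CX X) b (\<phi> n) - r\<bar> \<le> 1 / (real m + 1))" for m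
    using approx[rule_format, of "1 / (real m + 1)" "{..m}"] by simp
  then obtain c where c: "\<And>m. range (c m) \<subseteq> cs_ball (CX X) 1"
    "\<And>m n. n \<le> m \<Longrightarrow> \<exists>r\<in>K n. \<bar>cf_val (CX X) (c m) (\<phi> n) - r\<bar> \<le> 1 / (real m + 1)"
    by (metis atMost_iff)
  have cball: "c m k \<in> cs_ball (CX X) 1" for m k
    using c(1) by blast
  \<comment> \<open>The zero function ensures that \<open>Q\<close> is nonempty and can be
    enumerated.\<close>
  define Q where "Q = insert (\<lambda>x\<in>topspace X. 0) (\<Union>n. cf_params (\<phi> n))"
  have "countable Q"
    unfolding Q_def by (intro countable_insert countable_UN) (auto intro: countable_finite finite_cf_params)
  define q where "q = from_nat_into Q"
  have q: "range q = Q"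
    unfolding q_def using \<open>countable Q\<close> by (intro range_from_nat_into) (auto simp: Q_def)
  have Qball: "Q \<subseteq> cs_ball (CX X) 1"
    using \<phi> CX_zero_ball[of 1] by (auto simp: Q_def)
  have qball: "q k \<in> cs_ball (CX X) 1" for k
    using q Qball by blast
  obtain cod where cod: "\<And>h l e. h \<in> cs_ball (CX X) 1 \<Longrightarrow> clopenin X (cod h l e)"
    "\<And>h x. h \<in> cs_ball (CX X) 1 \<Longrightarrow> x \<in> topspace X \<Longrightarrow> h x = decode (\<lambda>l e. x \<in> cod h l e)"
    using complex_encode by metis
  \<comment> \<open>A single sequence lists all digit sets, by variable, position, and real or
    imaginary part.\<close>
  define idx where "idx j = (from_nat j :: nat \<times> nat \<times> bool)" for j
  define G where "G j = (case idx j of (k, l, e) \<Rightarrow> cod (q k) l e)" for j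
  define \<beta> where "\<beta> m j = (case idx j of (k, l, e) \<Rightarrow> cod (c m k) l e)" for m j
  have Gcl: "clopenin X (G j)" for j
    unfolding G_def by (auto split: prod.split intro: cod qball)
  have \<beta>cl: "clopenin X (\<beta> m j)" for m j
    unfolding \<beta>_def by (auto split: prod.split intro: cod cball)
  have G: "G (to_nat (k, l, e)) = cod (q k) l e" and \<beta>: "\<beta> m (to_nat (k, l, e)) = cod (c m k) l e" for m k l e
    by (simp_all add: G_def \<beta>_def idx_def)
  show "\<exists>b. range b \<subseteq> cs_ball (CX X) 1 \<and> (\<forall>n. cf_val (CX X) b (\<phi> n) \<in> K n)"
  proof (rule clopen_limit[OF sat Gcl \<beta>cl])
    fix b assume b: "\<And>j. clopenin X (b j)" "\<And>N. \<exists>m\<ge>N. bits_sim N G b (\<beta> m) \<and> bits_sim N G (\<beta> m) b"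
    define B where "B k = (\<lambda>x\<in>topspace X. decode (\<lambda>l e. x \<in> b (to_nat (k, l, e))))" for k :: nat
    have bound: "\<exists>M. \<forall>k<n. \<forall>l<L. \<forall>e. to_nat (k, l, e :: bool) < M" for n L :: nat
    proof -
      have "finite (to_nat ` ({..<n} \<times> {..<L} \<times> (UNIV :: bool set)))"
        by simp
      then obtain M where "\<forall>j\<in>to_nat ` ({..<n} \<times> {..<L} \<times> (UNIV :: bool set)). j < M"
        by (meson finite_nat_set_iff_bounded)
      then show ?thesis
        by (intro exI[of _ M]) auto
    qed
    \<comment> \<open>Level \<open>n\<close> is reached by the first \<open>L\<close> digits of the
      first \<open>n\<close> variables and of the parameters listed before \<open>k0\<close>;
      \<open>m0\<close> asks in addition for a late approximation.\<close>
    have key: "\<exists>m\<ge>m0. image_sim P n B (c m) \<and> image_sim P n (c m) B"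
      if P: "finite P" "P \<subseteq> Q" for P n m0
    proof -
      have "P \<subseteq> range q"
        using P(2) q by simp
      then obtain k0 where k0: "\<And>p. p \<in> P \<Longrightarrow> \<exists>i<k0. q i = p"
        using finite_subset_range_bound[OF P(1)] by metis
      have "0 < 1 / (real n + 1)"
        by simp
      then obtain L where L: "\<And>e e'. (\<And>l c. l < L \<Longrightarrow> e l c = e' l c) \<Longrightarrow> cmod (decode e - decode e') \<le> 1 / (real n + 1)"
        using decode_uniform by metis
      obtain M where M: "\<And>k l e. k < max n k0 \<Longrightarrow> l < L \<Longrightarrow> to_nat (k, l, e :: bool) < M"
        using bound[of "max n k0" L] by blast
      obtain m where m: "m \<ge> max m0 M" "bits_sim (max m0 M) G b (\<beta> m)" "bits_sim (max m0 M) G (\<beta> m) b"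
        using b(2) by blast
      have par: "cmod (p x - p y) \<le> 1 / (real n + 1)"
        if p: "p \<in> P" and xy: "x \<in> topspace X" "y \<in> topspace X" and bits: "\<And>j. j < max m0 M \<Longrightarrow> x \<in> G j \<longleftrightarrow> y \<in> G j" for p x y
      proof -
        obtain k where k: "k < k0" "q k = p"
          using k0[OF p] by blast
        have "x \<in> cod p l e \<longleftrightarrow> y \<in> cod p l e" if "l < L" for l e
          using bits[of "to_nat (k, l, e)"] M[of k l e] that k by (simp add: G less_max_iff_disj)
        then show ?thesis
          using L cod(2)[of p] xy p P(2) Qball by (simp add: subset_iff)
      qed
      have var: "cmod (B k x - c m k y) \<le> 1 / (real n + 1)"
        if k: "k < n" and xy: "x \<in> topspace X" "y \<in> topspace X" and bits: "\<And>j. j < max m0 M \<Longrightarrow> x \<in> b j \<longleftrightarrow> y \<in> \<beta> m j" for k x y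
      proof -
        have "x \<in> b (to_nat (k, l, e)) \<longleftrightarrow> y \<in> cod (c m k) l e" if "l < L" for l e
          using bits[of "to_nat (k, l, e)"] M[of k l e] that k by (simp add: \<beta> less_max_iff_disj)
        then show ?thesis
          using L cod(2)[OF cball xy(2)] xy(1) by (simp add: B_def)
      qed
      have "image_sim P n B (c m)"
        unfolding image_sim_def
      proof
        fix x assume x: "x \<in> topspace X"
        obtain y where y: "y \<in> topspace X" "\<And>j. j < max m0 M \<Longrightarrow> (x \<in> b j \<longleftrightarrow> y \<in> \<beta> m j) \<and> (x \<in> G j \<longleftrightarrow> y \<in> G j)"
          using m(2) x unfolding bits_sim_def by metis
        then have "close P n B (c m) x y"
          unfolding close_def using var par x by blast
        with y(1) show "\<exists>y\<in>topspace X. close P n B (c m) x y" ..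
      qed
      moreover have "image_sim P n (c m) B"
        unfolding image_sim_def
      proof
        fix y assume y: "y \<in> topspace X"
        obtain x where x: "x \<in> topspace X" "\<And>j. j < max m0 M \<Longrightarrow> (y \<in> \<beta> m j \<longleftrightarrow> x \<in> b j) \<and> (y \<in> G j \<longleftrightarrow> x \<in> G j)"
          using m(3) y unfolding bits_sim_def by metis
        have "cmod (c m k y - B k x) \<le> 1 / (real n + 1)" if "k < n" for k
          using var[OF that x(1) y] x(2) by (simp add: norm_minus_commute)
        then have "close P n (c m) B y x"
          unfolding close_def using par y x by blast
        with x(1) show "\<exists>x\<in>topspace X. close P n (c m) B y x" ..
      qed
      ultimately show ?thesis
        using m(1) by (intro exI[of _ m]) simp
    qed
    have Bball: "B k \<in> cs_ball (CX X) 1" for k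
    proof -
      have "continuous_map X euclidean (\<lambda>x. decode (\<lambda>l e. x \<in> b (to_nat (k, l, e))))"
      proof (rule continuous_mapI_locally)
        fix x and r :: real assume x: "x \<in> topspace X" and "0 < r"
        then obtain L where L: "\<And>e e'. (\<And>l c. l < L \<Longrightarrow> e l c = e' l c) \<Longrightarrow> cmod (decode e - decode e') \<le> r / 2"
          using decode_uniform[of "r / 2"] by auto
        obtain M where M: "\<And>l e. l < L \<Longrightarrow> to_nat (k, l, e :: bool) < M"
          using bound[of "Suc k" L] by blast
        define U where "U = {y \<in> topspace X. \<forall>j<M. (y \<in> b j) = (x \<in> b j)}"
        have "clopenin X U"
          unfolding U_def by (intro clopenin_agree b(1))
        moreover have "dist (decode (\<lambda>l e. x \<in> b (to_nat (k, l, e)))) (decode (\<lambda>l e. y \<in> b (to_nat (k, l, e)))) < r" if "y \<in> U" for y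
        proof -
          have "cmod (decode (\<lambda>l e. x \<in> b (to_nat (k, l, e))) - decode (\<lambda>l e. y \<in> b (to_nat (k, l, e)))) \<le> r / 2"
            using that M by (intro L) (simp add: U_def)
          then show ?thesis
            using \<open>0 < r\<close> by (simp add: dist_norm)
        qed
        ultimately show "\<exists>U. openin X U \<and> x \<in> U \<and>
            (\<forall>y\<in>U. dist (decode (\<lambda>l e. x \<in> b (to_nat (k, l, e)))) (decode (\<lambda>l e. y \<in> b (to_nat (k, l, e)))) < r)"
          using x by (intro exI[of _ U]) (auto simp: clopenin_def U_def)
      qed
      then have "continuous_map X euclidean (B k)"
        unfolding B_def by (auto elim: continuous_map_eq)
      \<comment> \<open>Decoding arbitrary digit sets bounds real and imaginary part separately, not
        the modulus. The bound 1 is inherited from the functions \<open>c m k\<close>, which come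
        arbitrarily close.\<close>
      moreover have "cmod (B k x) \<le> 1" if x: "x \<in> topspace X" for x
      proof (rule field_le_epsilon)
        fix r :: real assume "0 < r"
        then obtain n where n: "1 / (real n + 1) \<le> r" "Suc k \<le> n"
          using small_reciprocal by blast
        obtain m y where "y \<in> topspace X" "close {} n B (c m) x y"
          using key[of "{}" 0 n] x unfolding image_sim_def by auto
        then have "cmod (B k x - c m k y) \<le> r" "cmod (c m k y) \<le> 1"
          using n CX_ball_bound[OF cball] unfolding close_def by (meson Suc_le_lessD order_trans)+
        then show "cmod (B k x) \<le> 1 + r"
          using norm_triangle_sub[of "B k x" "c m k y"] by linarith
      qed
      ultimately show ?thesis
        by (simp add: mem_CX_ball B_def)
    qed
    have "cf_val (CX X) B (\<phi> j) \<in> K j" for j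
    proof -
      \<comment> \<open>One third of \<open>r\<close> is spent on passing from \<open>B\<close> to a
        late \<open>c m\<close>, another on the distance of its value from \<open>K j\<close>. The
        value at \<open>B\<close> then lies in \<open>K j\<close>, which is closed.\<close>
      have "\<exists>z\<in>K j. dist z (cf_val (CX X) B (\<phi> j)) < r" if "0 < r" for r
      proof -
        let ?P = "cf_params (\<phi> j)"
        have P: "finite ?P" "?P \<subseteq> cs_ball (CX X) 1" "cf_wf (\<phi> j)" "?P \<subseteq> Q" "0 < r / 3"
          using finite_cf_params \<phi> \<open>0 < r\<close> by (auto simp: Q_def)
        obtain n where n: "\<And>f g. f \<in> assignments 1 \<Longrightarrow> g \<in> assignments 1 \<Longrightarrow>
            image_sim ?P n f g \<Longrightarrow> image_sim ?P n g f \<Longrightarrow> \<bar>cf_val (CX X) f (\<phi> j) - cf_val (CX X) g (\<phi> j)\<bar> \<le> r / 3"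
          using cf_val_close[OF noiso P(1,2,3) order_refl P(5)] by metis
        obtain m0 where m0: "1 / (real m0 + 1) \<le> r / 3" "j \<le> m0"
          using small_reciprocal[OF P(5)] by metis
        obtain m where m: "m \<ge> m0" "image_sim ?P n B (c m)" "image_sim ?P n (c m) B"
          using key[OF P(1,4)] by blast
        have "B \<in> assignments 1" "c m \<in> assignments 1"
          using Bball cball by (auto simp: assignments_def)
        then have 1: "\<bar>cf_val (CX X) B (\<phi> j) - cf_val (CX X) (c m) (\<phi> j)\<bar> \<le> r / 3"
          using n m by blast
        obtain z where z: "z \<in> K j" "\<bar>cf_val (CX X) (c m) (\<phi> j) - z\<bar> \<le> 1 / (real m + 1)"
          using c(2)[of j m] m0 m by auto
        have "1 / (real m + 1) \<le> 1 / (real m0 + 1)"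
          using m(1) by (intro divide_left_mono) auto
        then have "dist z (cf_val (CX X) B (\<phi> j)) < r"
          using 1 z(2) m0(1) \<open>0 < r\<close> unfolding dist_real_def by linarith
        with z(1) show ?thesis ..
      qed
      then show ?thesis
        using closed_approachable[OF compact_imp_closed] K by blast
    qed
    with Bball show ?thesis
      by (intro exI[of _ B]) auto
  qed
qed

end

lemma countably_saturated_imp_degree1:
  assumes "countably_saturated C" shows "countably_degree1_saturated C"
proof -
  have wf: "cf_wf \<phi>" if "\<phi> \<in> {CNorm p | p. sp_degree p \<le> 1}" for \<phi> :: "'a cform"
    using that by auto
  show ?thesis
    unfolding countably_degree1_saturated_def countably_saturated_for_def
  proof (intro allI impI, elim conjE)
    fix \<phi> :: "nat \<Rightarrow> 'a cform" and K :: "nat \<Rightarrow> real set"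
    assume "\<forall>n. \<phi> n \<in> {CNorm p | p. sp_degree p \<le> 1} \<and> cf_params (\<phi> n) \<subseteq> cs_ball C 1"
      "\<forall>n. compact (K n)"
      "\<forall>\<epsilon>>0. \<forall>F. finite F \<longrightarrow>
        (\<exists>b. range b \<subseteq> cs_ball C 1 \<and> (\<forall>n\<in>F. \<exists>r\<in>K n. \<bar>cf_val C b (\<phi> n) - r\<bar> \<le> \<epsilon>))"
    then show "\<exists>b. range b \<subseteq> cs_ball C 1 \<and> (\<forall>n. cf_val C b (\<phi> n) \<in> K n)"
      using assms[unfolded countably_saturated_def countably_saturated_for_def, rule_format, of \<phi> K] wf by simp
  qed
qed

theorem mainTheorem7:
  fixes X :: "'a topology"
  assumes "compact_space X" and "Hausdorff_space X" and "X dim_le 0"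
    and "finite (isolated_points X)"
  shows "(countably_degree1_saturated (CX X) \<longrightarrow> ba_countably_saturated (CL X)) \<and>
         (isolated_points X = {} \<longrightarrow>
            (countably_degree1_saturated (CX X) \<longleftrightarrow> countably_saturated (CX X)))"
proof -
  interpret boolean_space X
    using assms by unfold_locales
  show ?thesis
    using CL_saturated CX_saturated assms(4) countably_saturated_imp_degree1 by blast
qed

end
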